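(* Let $\Phi\colon\mathbb{N}\times\mathbb{N}\to\mathbb{R}$ be a non-negative multiplicative function such that for every integer $k\geq1$ it holds that $$\sum_{mn=k}\Phi(m,n)=1.$$ Define the weighted projection $\mathcal{P}_\Phi$ by $$\mathcal{P}_\Phi\colon (a_{m,n})_{m,n\geq1}\mapsto (\varrho_{mn})_{m,n\geq1},\qquad \varrho_k=\sum_{mn=k}\Phi(m,n)\,a_{m,n}\quad(k\geq1).$$ Then $\mathcal{P}_\Phi$ is unbounded on the Schatten class $\mathcal{S}_q$ for every real $q$ with $1\leq q<\infty$ and $q\neq2$.
   Context: $\mathbb{N}=\{1,2,3,\dots\}$. A function of two variables $f\colon\mathbb{N}\times\mathbb{N}\to\mathbb{C}$ is called multiplicative if $f(1,1)=1$ and $f(m_1n_1,m_2n_2)=f(m_1,m_2)f(n_1,n_2)$ whenever $m_1m_2$ and $n_1n_2$ are coprime. Sums $\sum_{mn=k}$ run over all pairs $(m,n)\in\mathbb{N}\times\mathbb{N}$ with $mn=k$. Infinite complex matrices $(a_{m,n})_{m,n\geq 1}$ are regarded as linear operators on $\ell^2(\mathbb{N})$ with respect to the standard orthonormal basis. A compact operator $A$ on $\ell^2(\mathbb{N})$ belongs to the Schatten class $\mathcal{S}_q$ if its sequence of singular values $s(A)=(s_k(A))_{k\geq 0}$ is in $\ell^q$, and then $\|A\|_{\mathcal{S}_q}=\|s(A)\|_{\ell^q}$. A linear map $\mathcal{P}$ on infinite matrices is bounded on $\mathcal{S}_q$ if there is a constant $C<\infty$ such that for every $A\in\mathcal{S}_q$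 the matrix $\mathcal{P}A$ defines an operator in $\mathcal{S}_q$ with $\|\mathcal{P}A\|_{\mathcal{S}_q}\leq C\|A\|_{\mathcal{S}_q}$; it is unbounded on $\mathcal{S}_q$ if there is no such constant. *)

theory Defs
  imports "HOL-Analysis.Analysis"
begin

section \<open>The Hilbert space of square-summable sequences\<close>

text \<open>The index set is the set of positive integers; a sequence is stored as a function on
  all of \<^typ>\<open>nat\<close> whose value at the unused index 0 is 0.\<close>

typedef ell2 = "{x :: nat \<Rightarrow> complex. x 0 = 0 \<and> summable (\<lambda>n. (cmod (x n))\<^sup>2)}"
  morphisms coord Abs_ell2
  by (intro exI[of _ "\<lambda>_. 0"]) simp

setup_lifting type_definition_ell2

lemma coord_0 [simp]: "coord x 0 = 0"
  using coord[of x] by simp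

lemma summable_coord: "summable (\<lambda>n. (cmod (coord x n))\<^sup>2)"
  using coord[of x] by simp

lemma summable_norm_add_sq:
  fixes f g :: "nat \<Rightarrow> complex"
  assumes "summable (\<lambda>n. (cmod (f n))\<^sup>2)" "summable (\<lambda>n. (cmod (g n))\<^sup>2)"
  shows "summable (\<lambda>n. (cmod (f n + g n))\<^sup>2)"
proof (rule summable_comparison_test'[where N = 0])
  show "summable (\<lambda>n. 2 * (cmod (f n))\<^sup>2 + 2 * (cmod (g n))\<^sup>2)"
    using assms by (intro summable_add summable_mult)
  fix n
  have "(cmod (f n + g n))\<^sup>2 \<le> (cmod (f n) + cmod (g n))\<^sup>2"
    by (simp add: norm_triangle_ineq power_mono)
  also have "\<dots> \<le> 2 * (cmod (f n))\<^sup>2 + 2 * (cmod (g n))\<^sup>2"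
    using sum_squares_bound[of "cmod (f n)" "cmod (g n)"]
    by (simp add: power2_sum)
  finally show "norm ((cmod (f n + g n))\<^sup>2) \<le> 2 * (cmod (f n))\<^sup>2 + 2 * (cmod (g n))\<^sup>2"
    by simp
qed

lemma summable_norm_mult_sq:
  fixes f :: "nat \<Rightarrow> complex"
  assumes "summable (\<lambda>n. (cmod (f n))\<^sup>2)"
  shows "summable (\<lambda>n. (cmod (c * f n))\<^sup>2)"
  using summable_mult[OF assms, of "(cmod c)\<^sup>2"]
  by (simp add: norm_mult power_mult_distrib)

lemma summable_inner_coord: "summable (\<lambda>n. coord x n \<bullet> coord y n)"
proof (rule summable_comparison_test'[where N = 0])
  show "summable (\<lambda>n. (cmod (coord x n))\<^sup>2 + (cmod (coord y n))\<^sup>2)"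
    by (intro summable_add summable_coord)
  fix n
  have "\<bar>coord x n \<bullet> coord y n\<bar> \<le> cmod (coord x n) * cmod (coord y n)"
    by (rule Cauchy_Schwarz_ineq2)
  also have "\<dots> \<le> (cmod (coord x n))\<^sup>2 + (cmod (coord y n))\<^sup>2"
  proof -
    have "0 \<le> cmod (coord x n) * cmod (coord y n)"
      by simp
    then show ?thesis
      using sum_squares_bound[of "cmod (coord x n)" "cmod (coord y n)"] by linarith
  qed
  finally show "norm (coord x n \<bullet> coord y n) \<le> (cmod (coord x n))\<^sup>2 + (cmod (coord y n))\<^sup>2"
    by simp
qed

lift_definition cscale :: "complex \<Rightarrow> ell2 \<Rightarrow> ell2" is "\<lambda>c x n. c * x n"
  using summable_norm_mult_sq by auto

instantiation ell2 :: real_vector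
begin

lift_definition zero_ell2 :: ell2 is "\<lambda>_. 0"
  by simp

lift_definition plus_ell2 :: "ell2 \<Rightarrow> ell2 \<Rightarrow> ell2" is "\<lambda>x y n. x n + y n"
  using summable_norm_add_sq by auto

lift_definition uminus_ell2 :: "ell2 \<Rightarrow> ell2" is "\<lambda>x n. - x n"
  by simp

lift_definition minus_ell2 :: "ell2 \<Rightarrow> ell2 \<Rightarrow> ell2" is "\<lambda>x y n. x n - y n"
  using summable_norm_add_sq[where g = "\<lambda>n. - y n" for y] by fastforce

lift_definition scaleR_ell2 :: "real \<Rightarrow> ell2 \<Rightarrow> ell2" is "\<lambda>r x n. r *\<^sub>R x n"
  using summable_norm_mult_sq by (auto simp: scaleR_conv_of_real simp del: norm_mult)

instance
  by standard (transfer; simp add: fun_eq_iff algebra_simps)+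

end

global_interpretation cell2: vector_space cscale
  by standard (transfer; simp add: fun_eq_iff algebra_simps)+

text \<open>As usual for real structures on complex spaces, the real inner product is the real part
  of the complex one: on \<^typ>\<open>complex\<close>, \<open>z \<bullet> w\<close> is the real part of \<open>z * cnj w\<close>.\<close>

instantiation ell2 :: real_inner
begin

definition inner_ell2 :: "ell2 \<Rightarrow> ell2 \<Rightarrow> real" where
  "inner_ell2 x y = (\<Sum>n. coord x n \<bullet> coord y n)"

definition norm_ell2 :: "ell2 \<Rightarrow> real" where
  "norm_ell2 x = sqrt (x \<bullet> x)"

definition sgn_ell2 :: "ell2 \<Rightarrow> ell2" where
  "sgn_ell2 x = x /\<^sub>R norm x"

definition dist_ell2 :: "ell2 \<Rightarrow> ell2 \<Rightarrow> real" where
  "dist_ell2 x y = norm (x - y)"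

definition uniformity_ell2 :: "(ell2 \<times> ell2) filter" where
  "uniformity_ell2 = (INF e\<in>{0<..}. principal {(x, y). dist x y < e})"

definition open_ell2 :: "ell2 set \<Rightarrow> bool" where
  "open_ell2 U = (\<forall>x\<in>U. eventually (\<lambda>(x', y). x' = x \<longrightarrow> y \<in> U) uniformity)"

instance
proof
  fix x y z :: ell2 and r :: real
  show "dist x y = norm (x - y)" by (rule dist_ell2_def)
  show "sgn x = x /\<^sub>R norm x" by (rule sgn_ell2_def)
  show "(uniformity :: (ell2 \<times> ell2) filter) = (INF e\<in>{0<..}. principal {(x, y). dist x y < e})"
    by (rule uniformity_ell2_def)
  show "open U \<longleftrightarrow> (\<forall>x\<in>U. eventually (\<lambda>(x', y). x' = x \<longrightarrow> y \<in> U) uniformity)" for U :: "ell2 set"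
    by (rule open_ell2_def)
  show "x \<bullet> y = y \<bullet> x"
    by (simp add: inner_ell2_def inner_commute)
  show "(x + y) \<bullet> z = x \<bullet> z + y \<bullet> z"
    by (simp add: inner_ell2_def plus_ell2.rep_eq inner_add_left suminf_add summable_inner_coord)
  show "(r *\<^sub>R x) \<bullet> y = r * (x \<bullet> y)"
    by (simp add: inner_ell2_def scaleR_ell2.rep_eq suminf_mult summable_inner_coord)
  show "0 \<le> x \<bullet> x"
    by (simp add: inner_ell2_def suminf_nonneg summable_inner_coord)
  have "x \<bullet> x = 0 \<longleftrightarrow> (\<forall>n. coord x n \<bullet> coord x n = 0)"
    unfolding inner_ell2_def by (rule suminf_eq_zero_iff) (auto intro: summable_inner_coord)
  also have "\<dots> \<longleftrightarrow> x = 0"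
    by (simp add: coord_inject[symmetric] zero_ell2.rep_eq fun_eq_iff)
  finally show "x \<bullet> x = 0 \<longleftrightarrow> x = 0" .
  show "norm x = sqrt (x \<bullet> x)" by (rule norm_ell2_def)
qed

end

text \<open>The standard orthonormal basis vectors are \<open>ebasis n\<close> for \<open>n \<ge> 1\<close>.\<close>

lift_definition ebasis :: "nat \<Rightarrow> ell2" is
  "\<lambda>n k. if k = n \<and> k \<noteq> 0 then 1 else 0"
proof
  fix n :: nat
  have "(\<lambda>k. (cmod (if k = n \<and> k \<noteq> 0 then 1 else 0))\<^sup>2) sums
    (\<Sum>k\<in>{n}. (cmod (if k = n \<and> k \<noteq> 0 then 1 else 0))\<^sup>2)"
    by (rule sums_finite) auto
  then show "summable (\<lambda>k. (cmod (if k = n \<and> k \<noteq> 0 then 1 else 0))\<^sup>2)"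
    by (rule sums_summable)
qed auto


section \<open>Operators, singular values and Schatten classes\<close>

definition bounded_op :: "(ell2 \<Rightarrow> ell2) \<Rightarrow> bool" where
  "bounded_op T \<longleftrightarrow> bounded_linear T \<and> (\<forall>c x. T (cscale c x) = cscale c (T x))"

definition compact_op :: "(ell2 \<Rightarrow> ell2) \<Rightarrow> bool" where
  "compact_op T \<longleftrightarrow> bounded_op T \<and> compact (closure (T ` cball 0 1))"

text \<open>\<open>(a\<^sub>m\<^sub>,\<^sub>n)\<close> is the matrix of \<open>T\<close> with respect to the standard basis; entries with a zero
  index are irrelevant.\<close>

definition has_matrix :: "(ell2 \<Rightarrow> ell2) \<Rightarrow> (nat \<Rightarrow> nat \<Rightarrow> complex) \<Rightarrow> bool" where
  "has_matrix T a \<longleftrightarrow> (\<forall>m\<ge>1. \<forall>n\<ge>1. coord (T (ebasis n)) m = a m n)"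

text \<open>For a complex-linear operator, the adjoint with respect to the real inner product
  is also the adjoint with respect to the complex one.

  The singular values of a compact operator \<open>T\<close> are the square roots of the eigenvalues of
  \<open>T\<^sup>* T\<close>, arranged in nonincreasing order and repeated according to (complex) multiplicity; if
  there are only finitely many positive ones, the sequence is continued by zeros.\<close>

definition singular_eigenspace :: "(ell2 \<Rightarrow> ell2) \<Rightarrow> real \<Rightarrow> ell2 set" where
  "singular_eigenspace T t = {x. adjoint T (T x) = t\<^sup>2 *\<^sub>R x}"

definition singular_values :: "(ell2 \<Rightarrow> ell2) \<Rightarrow> nat \<Rightarrow> real" where
  "singular_values T = (THE s. antimono s \<and> (\<forall>k. 0 \<le> s k) \<and>
     (\<forall>t>0. finite {k. s k = t} \<and> card {k. s k = t} = cell2.dim (singular_eigenspace T t)))"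

definition schatten_class :: "real \<Rightarrow> (ell2 \<Rightarrow> ell2) set" where
  "schatten_class q = {T. compact_op T \<and> summable (\<lambda>k. singular_values T k powr q)}"

definition schatten_norm :: "real \<Rightarrow> (ell2 \<Rightarrow> ell2) \<Rightarrow> real" where
  "schatten_norm q T = (\<Sum>k. singular_values T k powr q) powr (1 / q)"

definition bounded_on_schatten ::
    "real \<Rightarrow> ((nat \<Rightarrow> nat \<Rightarrow> complex) \<Rightarrow> nat \<Rightarrow> nat \<Rightarrow> complex) \<Rightarrow> bool" where
  "bounded_on_schatten q P \<longleftrightarrow>
     (\<exists>C. \<forall>A a. A \<in> schatten_class q \<and> has_matrix A a \<longrightarrow>
        (\<exists>B \<in> schatten_class q. has_matrix B (P a) \<and> schatten_norm q B \<le> C * schatten_norm q A))"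


section \<open>Multiplicative functions of two variables and weighted projections\<close>

definition multiplicative2 :: "(nat \<Rightarrow> nat \<Rightarrow> 'a :: comm_semiring_1) \<Rightarrow> bool" where
  "multiplicative2 f \<longleftrightarrow> f 1 1 = 1 \<and>
     (\<forall>m1\<ge>1. \<forall>n1\<ge>1. \<forall>m2\<ge>1. \<forall>n2\<ge>1. coprime (m1 * m2) (n1 * n2) \<longrightarrow>
        f (m1 * n1) (m2 * n2) = f m1 m2 * f n1 n2)"

definition factor_pairs :: "nat \<Rightarrow> (nat \<times> nat) set" where
  "factor_pairs k = {(m, n). m \<ge> 1 \<and> n \<ge> 1 \<and> m * n = k}"

definition weighted_projection ::
    "(nat \<Rightarrow> nat \<Rightarrow> real) \<Rightarrow> (nat \<Rightarrow> nat \<Rightarrow> complex) \<Rightarrow> nat \<Rightarrow> nat \<Rightarrow> complex" where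
  "weighted_projection \<Phi> a =
     (\<lambda>m n. \<Sum>(i, j)\<in>factor_pairs (m * n). complex_of_real (\<Phi> i j) * a i j)"

end

theory Submission
  imports Defs "HOL-Computational_Algebra.Primes"
begin

text \<open>
  The projection is amplified by tensor products over primes. A matrix indexed by the divisors
  of \<open>K p\<^sup>2\<close>, with \<open>p\<close> a prime not dividing \<open>K\<close>, can be a tensor product of a matrix indexed by the
  divisors of \<open>K\<close> and a \<open>3 \<times> 3\<close> matrix indexed by the exponents \<open>0, 1, 2\<close> of \<open>p\<close>. Because
  \<open>\<Phi>\<close> is multiplicative, the weighted projection acts on the two factors separately, and singular
  values of tensor products multiply. If for each prime the local projection increases
  \<open>\<Sum> s\<^sub>k\<^sup>q\<close> of a suitable local matrix by a factor at least \<open>R\<close>, where \<open>R > 1\<close> is the same for all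
  primes, then \<open>d\<close> primes together give the factor \<open>R\<^sup>d\<close>, and no constant can bound the projection
  (\<open>amplifies_mult\<close>, \<open>bounded_imp_amplification_bounded\<close>).

  The local problem (\<open>uniform_local_amplification\<close>) depends on the prime only through the weights
  \<open>\<phi> i j = \<Phi>(p\<^sup>i, p\<^sup>j)\<close> with \<open>i + j \<le> 2\<close>, and the gain has to be uniform in them. Since
  the weights on the antidiagonal \<open>i + j = 2\<close> add up to 1, there are two cases. If \<open>\<phi> 0 2\<close> is
  small, a matrix with two entries 1 on this antidiagonal, avoiding the position \<open>(0, 2)\<close>, is averaged
  to one with three entries not much smaller than 1. Otherwise the local matrix is
  \<open>[[1, \<surd>2, -r\<epsilon>], [\<surd>2, \<epsilon>, 0], [0, 0, 0]]\<close>, where \<open>r\<close> is such that the entries with \<open>\<epsilon>\<close>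
  average to 0, so that the projection just removes them. The matrix with \<open>\<epsilon> = 0\<close> has singular
  values 2 and 1. The perturbation changes the sum of the squared singular values to second order
  in \<open>\<epsilon>\<close>, but their product to first order; hence the two squares move in opposite directions,
  and as the derivatives of \<open>x\<^bsup>q/2\<^esup>\<close> at 4 and 1 differ for \<open>q \<noteq> 2\<close>, the right sign of \<open>\<epsilon>\<close> makes the
  \<open>q\<close>-norm of the perturbed matrix strictly smaller than that of its projection
  (\<open>perturbed_power_sum_less\<close>). For \<open>q = 2\<close> the two derivatives agree and the argument breaks down, as
  it must, the averaging projection being orthogonal then.

  On the operator side one needs that a finite matrix with a singular value decomposition is an
  operator with exactly these singular values (\<open>schatten_fin_op\<close>), and that a bounded operator is
  determined by its matrix (\<open>has_matrix_unique\<close>).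
\<close>

section \<open>Finite matrices as operators\<close>

definition orthonormal_on :: "nat set \<Rightarrow> 'i set \<Rightarrow> ('i \<Rightarrow> nat \<Rightarrow> real) \<Rightarrow> bool" where
  "orthonormal_on F J u \<longleftrightarrow>
     (\<forall>i\<in>J. \<forall>j\<in>J. (\<Sum>n\<in>F. u i n * u j n) = (if i = j then 1 else 0))"

text \<open>A reduced decomposition, without vanishing singular values. The index set \<open>J\<close> is arbitrary, so
  that a tensor product can be indexed by pairs.\<close>

definition svd :: "nat set \<Rightarrow> (nat \<Rightarrow> nat \<Rightarrow> real) \<Rightarrow> 'i set \<Rightarrow> ('i \<Rightarrow> real) \<Rightarrow>
    ('i \<Rightarrow> nat \<Rightarrow> real) \<Rightarrow> ('i \<Rightarrow> nat \<Rightarrow> real) \<Rightarrow> bool" where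
  "svd F a J s u v \<longleftrightarrow> finite F \<and> finite J \<and> (\<forall>j\<in>J. 0 < s j) \<and>
     orthonormal_on F J u \<and> orthonormal_on F J v \<and>
     (\<forall>m\<in>F. \<forall>n\<in>F. a m n = (\<Sum>j\<in>J. s j * u j m * v j n))"

lemma coord_simps [simp]:
  "coord 0 n = 0" "coord (x + y) n = coord x n + coord y n"
  "coord (x - y) n = coord x n - coord y n" "coord (- x) n = - coord x n"
  "coord (r *\<^sub>R x) n = r *\<^sub>R coord x n" "coord (cscale c x) n = c * coord x n"
  "coord (ebasis m) n = (if n = m \<and> n \<noteq> 0 then 1 else 0)"
  by (simp_all add: zero_ell2.rep_eq plus_ell2.rep_eq minus_ell2.rep_eq uminus_ell2.rep_eq
    scaleR_ell2.rep_eq cscale.rep_eq ebasis.rep_eq)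

lemma coord_sum [simp]: "coord (sum f A) n = (\<Sum>i\<in>A. coord (f i) n)"
  by (induction A rule: infinite_finite_induct) simp_all

lemma ell2_eqI: "(\<And>n. 1 \<le> n \<Longrightarrow> coord x n = coord y n) \<Longrightarrow> x = y"
  unfolding coord_inject[symmetric] by (rule ext) (metis coord_0 less_one linorder_not_le)

lemma inner_eq_sum:
  assumes "finite F" "\<And>n. n \<notin> F \<Longrightarrow> coord x n \<bullet> coord y n = 0"
  shows "x \<bullet> y = (\<Sum>n\<in>F. coord x n \<bullet> coord y n)"
  unfolding inner_ell2_def using assms by (rule suminf_finite)

lemma norm_sq_eq_suminf: "(norm x)\<^sup>2 = (\<Sum>n. (cmod (coord x n))\<^sup>2)" for x :: ell2
  unfolding power2_norm_eq_inner inner_ell2_def by (simp add: power2_norm_eq_inner)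

lemma norm_coord_le: "cmod (coord x n) \<le> norm x"
proof -
  have "(\<Sum>k\<in>{n}. (cmod (coord x k))\<^sup>2) \<le> (\<Sum>k. (cmod (coord x k))\<^sup>2)"
    by (rule sum_le_suminf[OF summable_coord]) auto
  then have "(cmod (coord x n))\<^sup>2 \<le> (norm x)\<^sup>2" by (simp add: norm_sq_eq_suminf)
  then show ?thesis by (rule power2_le_imp_le) simp
qed

lemma norm_cscale_ebasis_le: "norm (cscale c (ebasis m)) \<le> cmod c"
proof -
  have "(norm (cscale c (ebasis m)))\<^sup>2 = (\<Sum>n\<in>{m}. (cmod (coord (cscale c (ebasis m)) n))\<^sup>2)"
    unfolding norm_sq_eq_suminf by (rule suminf_finite) auto
  also have "\<dots> \<le> (cmod c)\<^sup>2" by simp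
  finally show ?thesis by (rule power2_le_imp_le) simp
qed

definition vec_on :: "nat set \<Rightarrow> (nat \<Rightarrow> complex) \<Rightarrow> ell2" where
  "vec_on F f = (\<Sum>m\<in>F. cscale (f m) (ebasis m))"

lemma coord_vec_on: "finite F \<Longrightarrow> 0 \<notin> F \<Longrightarrow> coord (vec_on F f) n = (if n \<in> F then f n else 0)"
proof -
  assume F: "finite F" "0 \<notin> F"
  have "(\<Sum>m\<in>F. coord (cscale (f m) (ebasis m)) n) = (\<Sum>m\<in>F. if m = n then f n else 0)"
    by (rule sum.cong) (use F in auto)
  then show ?thesis using F by (simp add: vec_on_def)
qed

definition fin_op :: "nat set \<Rightarrow> (nat \<Rightarrow> nat \<Rightarrow> real) \<Rightarrow> ell2 \<Rightarrow> ell2" where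
  "fin_op F a x = vec_on F (\<lambda>m. \<Sum>n\<in>F. of_real (a m n) * coord x n)"

lemma coord_fin_op: "finite F \<Longrightarrow> 0 \<notin> F \<Longrightarrow>
    coord (fin_op F a x) m = (if m \<in> F then \<Sum>n\<in>F. of_real (a m n) * coord x n else 0)"
  by (simp add: fin_op_def coord_vec_on)

lemma fin_op_add: "finite F \<Longrightarrow> 0 \<notin> F \<Longrightarrow> fin_op F a (x + y) = fin_op F a x + fin_op F a y"
  by (rule ell2_eqI) (simp add: coord_fin_op algebra_simps sum.distrib)

lemma fin_op_cscale: "finite F \<Longrightarrow> 0 \<notin> F \<Longrightarrow> fin_op F a (cscale c x) = cscale c (fin_op F a x)"
  by (rule ell2_eqI) (simp add: coord_fin_op sum_distrib_left mult_ac)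

lemma scaleR_eq_cscale: "r *\<^sub>R x = cscale (of_real r) x"
  by (rule ell2_eqI) (simp add: scaleR_conv_of_real)

lemma cmod_row_le:
  "cmod (\<Sum>n\<in>F. of_real (a n) * coord x n) \<le> (\<Sum>n\<in>F. \<bar>a n\<bar>) * norm x"
  unfolding sum_distrib_right
  by (rule order_trans[OF norm_sum], rule sum_mono)
     (simp add: norm_mult mult_left_mono norm_coord_le)

lemma bounded_op_fin_op:
  assumes "finite F" "0 \<notin> F"
  shows "bounded_op (fin_op F a)"
  unfolding bounded_op_def
proof (intro conjI allI)
  show "fin_op F a (cscale c x) = cscale c (fin_op F a x)" for c x
    using assms by (rule fin_op_cscale)
  show "bounded_linear (fin_op F a)"
  proof (rule bounded_linear_intro[where K = "\<Sum>m\<in>F. \<Sum>n\<in>F. \<bar>a m n\<bar>"])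
    fix x
    have "norm (fin_op F a x) \<le> (\<Sum>m\<in>F. cmod (\<Sum>n\<in>F. of_real (a m n) * coord x n))"
      unfolding fin_op_def vec_on_def
      by (rule order_trans[OF norm_sum], rule sum_mono) (rule norm_cscale_ebasis_le)
    also have "\<dots> \<le> (\<Sum>m\<in>F. (\<Sum>n\<in>F. \<bar>a m n\<bar>) * norm x)"
      by (rule sum_mono) (rule cmod_row_le)
    finally show "norm (fin_op F a x) \<le> norm x * (\<Sum>m\<in>F. \<Sum>n\<in>F. \<bar>a m n\<bar>)"
      by (simp add: sum_distrib_left mult.commute)
  qed (use assms in \<open>simp_all add: fin_op_add scaleR_eq_cscale fin_op_cscale\<close>)
qed

text \<open>A finite product of discs is compact; the image of the unit ball under an operator with finite
  matrix lies in such a box.\<close>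

lemma compact_box:
  assumes "finite F"
  shows "\<exists>S. compact S \<and> (\<forall>f. (\<forall>m\<in>F. cmod (f m) \<le> M m) \<longrightarrow> vec_on F f \<in> S)"
  using assms
proof induction
  case empty
  show ?case by (intro exI[of _ "{0}"]) (simp add: vec_on_def)
next
  case (insert k F)
  then obtain S where S: "compact S" "\<And>f. (\<forall>m\<in>F. cmod (f m) \<le> M m) \<Longrightarrow> vec_on F f \<in> S"
    by blast
  let ?K = "(\<lambda>c. cscale c (ebasis k)) ` cball 0 (M k)"
  have "bounded_linear (\<lambda>c. cscale c (ebasis k))"
    by (rule bounded_linear_intro[where K = 1])
       (auto simp: norm_cscale_ebasis_le scaleR_eq_cscale scaleR_conv_of_real cell2.scale_left_distrib)
  then have "continuous_on (cball 0 (M k)) (\<lambda>c. cscale c (ebasis k))"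
    by (rule linear_continuous_on)
  then have K: "compact ?K" by (rule compact_continuous_image) simp
  show ?case
  proof (intro exI conjI allI impI)
    show "compact {x + y | x y. x \<in> ?K \<and> y \<in> S}" using K S(1) by (rule compact_sums)
    fix f assume f: "\<forall>m\<in>insert k F. cmod (f m) \<le> M m"
    have "vec_on (insert k F) f = cscale (f k) (ebasis k) + vec_on F f"
      using insert by (simp add: vec_on_def)
    moreover have "cscale (f k) (ebasis k) \<in> ?K" "vec_on F f \<in> S" using f S(2) by auto
    ultimately show "vec_on (insert k F) f \<in> {x + y | x y. x \<in> ?K \<and> y \<in> S}" by blast
  qed
qed

lemma compact_op_fin_op:
  assumes "finite F" "0 \<notin> F"
  shows "compact_op (fin_op F a)"
proof -
  obtain S where S: "compact S"
    "\<And>f. (\<forall>m\<in>F. cmod (f m) \<le> (\<Sum>n\<in>F. \<bar>a m n\<bar>)) \<Longrightarrow> vec_on F f \<in> S"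
    using compact_box[OF assms(1), of "\<lambda>m. \<Sum>n\<in>F. \<bar>a m n\<bar>"] by blast
  have "fin_op F a ` cball 0 1 \<subseteq> S"
  proof clarify
    fix x :: ell2 assume x: "x \<in> cball 0 1"
    show "fin_op F a x \<in> S" unfolding fin_op_def
    proof (rule S(2), rule ballI)
      fix m
      show "cmod (\<Sum>n\<in>F. of_real (a m n) * coord x n) \<le> (\<Sum>n\<in>F. \<bar>a m n\<bar>)"
        using x by (intro order_trans[OF cmod_row_le] mult_left_le sum_nonneg) auto
    qed
  qed
  then have "closure (fin_op F a ` cball 0 1) \<subseteq> S"
    using S(1) by (intro closure_minimal compact_imp_closed)
  then have "compact (closure (fin_op F a ` cball 0 1))"
    using S(1) compact_Int_closed[of S "closure (fin_op F a ` cball 0 1)"] by (simp add: Int_absorb1)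
  then show ?thesis using assms by (simp add: compact_op_def bounded_op_fin_op)
qed

lemma has_matrix_fin_op:
  assumes "finite F" "0 \<notin> F" "\<And>m n. \<not> (m \<in> F \<and> n \<in> F) \<Longrightarrow> a m n = 0"
  shows "has_matrix (fin_op F a) (\<lambda>m n. of_real (a m n))"
  unfolding has_matrix_def
proof (intro allI impI)
  fix m n :: nat assume "1 \<le> m" "1 \<le> n"
  then have "(\<Sum>k\<in>F. of_real (a m k) * coord (ebasis n) k) = (\<Sum>k\<in>F. if k = n then complex_of_real (a m n) else 0)"
    by (intro sum.cong) auto
  then show "coord (fin_op F a (ebasis n)) m = of_real (a m n)"
    using assms by (auto simp: coord_fin_op)
qed

lemma vec_on_tendsto: "(\<lambda>N. vec_on {1..N} (coord x)) \<longlonglongrightarrow> x"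
proof -
  have "(\<lambda>N. (norm (x - vec_on {1..N} (coord x)))\<^sup>2) \<longlonglongrightarrow> 0"
  proof -
    have "(norm (x - vec_on {1..N} (coord x)))\<^sup>2 = (\<Sum>n. (cmod (coord x (n + Suc N)))\<^sup>2)" for N
    proof -
      have eq: "(cmod (coord (x - vec_on {1..N} (coord x)) n))\<^sup>2 =
          (if n < Suc N then 0 else (cmod (coord x n))\<^sup>2)" for n
        by (cases "n = 0") (auto simp: coord_vec_on)
      let ?f = "\<lambda>n. (cmod (coord (x - vec_on {1..N} (coord x)) n))\<^sup>2"
      have "suminf ?f = (\<Sum>n. ?f (n + Suc N)) + sum ?f {..<Suc N}"
        by (rule suminf_split_initial_segment) (rule summable_coord)
      also have "sum ?f {..<Suc N} = 0" unfolding eq by (rule sum.neutral) simp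
      finally show ?thesis unfolding norm_sq_eq_suminf eq by simp
    qed
    moreover have "(\<lambda>N. \<Sum>n. (cmod (coord x (n + Suc N)))\<^sup>2) \<longlonglongrightarrow> 0"
      using suminf_exist_split2[OF summable_coord[of x]] by (rule LIMSEQ_Suc)
    ultimately show ?thesis by simp
  qed
  then have "(\<lambda>N. norm (x - vec_on {1..N} (coord x))) \<longlonglongrightarrow> 0"
    using tendsto_real_sqrt by fastforce
  then have "(\<lambda>N. x - vec_on {1..N} (coord x)) \<longlonglongrightarrow> 0"
    by (rule tendsto_norm_zero_cancel)
  from tendsto_diff[OF tendsto_const[of x] this] show ?thesis by simp
qed

text \<open>The truncations of \<open>x\<close> are finite combinations of basis vectors and converge to \<open>x\<close>. This
  is what pins down the operator whose matrix is the projected one.\<close>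

lemma has_matrix_unique:
  assumes S: "bounded_op S" "has_matrix S a" and T: "bounded_op T" "has_matrix T a"
  shows "S = T"
proof
  fix x
  have eb: "S (ebasis n) = T (ebasis n)" if "1 \<le> n" for n
    by (rule ell2_eqI) (use S T that in \<open>auto simp: has_matrix_def\<close>)
  have lin: "R (vec_on {1..N} f) = (\<Sum>n=1..N. cscale (f n) (R (ebasis n)))" if "bounded_op R" for R N f
    using that by (simp add: vec_on_def bounded_op_def bounded_linear.linear linear_sum)
  have eq: "S (vec_on {1..N} (coord x)) = T (vec_on {1..N} (coord x))" for N
    unfolding lin[OF S(1)] lin[OF T(1)] by (rule sum.cong) (auto simp: eb)
  have "(\<lambda>N. R (vec_on {1..N} (coord x))) \<longlonglongrightarrow> R x" if "bounded_op R" for R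
    using that bounded_linear.tendsto[OF _ vec_on_tendsto] unfolding bounded_op_def by blast
  from this[OF S(1)] this[OF T(1)] show "S x = T x" unfolding eq by (rule LIMSEQ_unique)
qed

lemma adjoint_fin_op:
  assumes "finite F" "0 \<notin> F"
  shows "adjoint (fin_op F a) = fin_op F (\<lambda>m n. a n m)"
proof (rule adjoint_unique, intro allI)
  fix x y
  have "fin_op F a x \<bullet> y = (\<Sum>m\<in>F. (\<Sum>n\<in>F. of_real (a m n) * coord x n) \<bullet> coord y m)"
    by (subst inner_eq_sum[OF assms(1)]) (auto simp: coord_fin_op assms)
  also have "\<dots> = (\<Sum>m\<in>F. \<Sum>n\<in>F. a m n * (coord x n \<bullet> coord y m))"
    by (simp add: inner_sum_left flip: scaleR_conv_of_real)
  also have "\<dots> = (\<Sum>n\<in>F. \<Sum>m\<in>F. a m n * (coord x n \<bullet> coord y m))"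
    by (rule sum.swap)
  also have "\<dots> = (\<Sum>n\<in>F. coord x n \<bullet> (\<Sum>m\<in>F. of_real (a m n) * coord y m))"
    by (simp add: inner_sum_right flip: scaleR_conv_of_real)
  also have "\<dots> = x \<bullet> fin_op F (\<lambda>m n. a n m) y"
    by (subst inner_eq_sum[OF assms(1)]) (auto simp: coord_fin_op assms)
  finally show "fin_op F a x \<bullet> y = x \<bullet> fin_op F (\<lambda>m n. a n m) y" .
qed

section \<open>Singular values of finite matrices\<close>

lemma sum_of_real_ortho:
  assumes "finite J" "orthonormal_on F J u" "i \<in> J"
  shows "(\<Sum>n\<in>F. of_real (u i n) * (\<Sum>j\<in>J. c j * of_real (u j n))) = (c i :: complex)"
proof -
  have "(\<Sum>n\<in>F. of_real (u i n) * (\<Sum>j\<in>J. c j * of_real (u j n)))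
      = (\<Sum>n\<in>F. \<Sum>j\<in>J. c j * of_real (u i n * u j n))"
    by (simp add: sum_distrib_left mult_ac)
  also have "\<dots> = (\<Sum>j\<in>J. c j * of_real (\<Sum>n\<in>F. u i n * u j n))"
    by (subst sum.swap) (simp add: sum_distrib_left)
  also have "\<dots> = (\<Sum>j\<in>J. if j = i then c i else 0)"
    using assms by (intro sum.cong) (auto simp: orthonormal_on_def)
  also have "\<dots> = c i" using assms by simp
  finally show ?thesis .
qed

text \<open>With \<open>c\<^sub>j\<close> the coordinate of \<open>x\<close> along \<open>v\<^sub>j\<close>, the operator \<open>T\<^sup>* T\<close> maps \<open>x\<close> to the sum of
  \<open>s\<^sub>j\<^sup>2 c\<^sub>j v\<^sub>j\<close>. Comparing coordinates shows that the right singular vectors with \<open>s\<^sub>j = t\<close> form a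
  basis of the eigenspace.\<close>

lemma dim_singular_eigenspace:
  assumes svd: "svd F a J s u v" and F: "0 \<notin> F" and t: "0 < t"
  shows "cell2.dim (singular_eigenspace (fin_op F a) t) = card {j\<in>J. s j = t}"
proof -
  have fin: "finite F" "finite J" and pos: "\<And>j. j \<in> J \<Longrightarrow> 0 < s j"
    and ou: "orthonormal_on F J u" and ov: "orthonormal_on F J v"
    and a: "\<And>m n. m \<in> F \<Longrightarrow> n \<in> F \<Longrightarrow> a m n = (\<Sum>j\<in>J. s j * u j m * v j n)"
    using svd by (auto simp: svd_def)
  define C where "C x j = (\<Sum>n\<in>F. of_real (v j n) * coord x n)" for x j
  define w where "w j = vec_on F (\<lambda>n. of_real (v j n))" for j
  define E where "E = singular_eigenspace (fin_op F a) t"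
  define I where "I = {j\<in>J. s j = t}"
  have I: "finite I" "I \<subseteq> J" using fin by (auto simp: I_def)
  have C_add: "C (x + y) j = C x j + C y j" for x y j
    by (simp add: C_def algebra_simps sum.distrib)
  have C_scale: "C (cscale c x) j = c * C x j" for c x j
    by (simp add: C_def sum_distrib_left mult_ac)
  have C_sum: "C (sum f A) j = (\<Sum>i\<in>A. C (f i) j)" for f :: "'a \<Rightarrow> ell2" and A j
    by (induction A rule: infinite_finite_induct) (simp_all add: C_add, simp_all add: C_def)
  have coord_w: "coord (w j) n = (if n \<in> F then of_real (v j n) else 0)" for j n
    using fin F by (simp add: w_def coord_vec_on)
  have Cw: "C (w i) j = (if i = j then 1 else 0)" if "i \<in> J" "j \<in> J" for i j
  proof -
    have "C (w i) j = of_real (\<Sum>n\<in>F. v j n * v i n)" by (simp add: C_def coord_w)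
    also have "(\<Sum>n\<in>F. v j n * v i n) = (if i = j then 1 else 0)"
      using ov that by (auto simp: orthonormal_on_def)
    finally show ?thesis by simp
  qed
  have row: "(\<Sum>n\<in>F. of_real (a m n) * coord x n) = (\<Sum>j\<in>J. (of_real (s j) * C x j) * of_real (u j m))"
    if "m \<in> F" for m x
  proof -
    have "(\<Sum>n\<in>F. of_real (a m n) * coord x n) = (\<Sum>n\<in>F. \<Sum>j\<in>J. of_real (s j * u j m) * (of_real (v j n) * coord x n))"
      using that by (simp add: a sum_distrib_right mult.assoc)
    also have "\<dots> = (\<Sum>j\<in>J. of_real (s j * u j m) * C x j)"
      by (subst sum.swap) (simp add: sum_distrib_left C_def)
    finally show ?thesis by (simp add: mult_ac)
  qed
  have TT: "adjoint (fin_op F a) (fin_op F a x) = (\<Sum>j\<in>J. cscale (of_real ((s j)\<^sup>2) * C x j) (w j))" for x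
  proof (rule ell2_eqI)
    fix k
    have lhs: "coord (adjoint (fin_op F a) (fin_op F a x)) k =
       (if k \<in> F then \<Sum>m\<in>F. of_real (a m k) * (\<Sum>j\<in>J. (of_real (s j) * C x j) * of_real (u j m)) else 0)"
      using fin F by (simp add: adjoint_fin_op coord_fin_op row)
    have rhs: "(\<Sum>m\<in>F. of_real (a m k) * (\<Sum>j\<in>J. (of_real (s j) * C x j) * of_real (u j m)))
      = (\<Sum>j\<in>J. of_real ((s j)\<^sup>2) * C x j * of_real (v j k))" if "k \<in> F"
    proof -
      define G where "G m = (\<Sum>j\<in>J. (of_real (s j) * C x j) * of_real (u j m))" for m
      have "(\<Sum>m\<in>F. of_real (a m k) * G m) = (\<Sum>m\<in>F. \<Sum>i\<in>J. of_real (s i * v i k) * (of_real (u i m) * G m))"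
        using that by (simp add: a sum_distrib_left sum_distrib_right mult_ac)
      also have "\<dots> = (\<Sum>i\<in>J. of_real (s i * v i k) * (\<Sum>m\<in>F. of_real (u i m) * G m))"
        by (subst sum.swap) (simp add: sum_distrib_left)
      also have "\<dots> = (\<Sum>i\<in>J. of_real (s i * v i k) * (of_real (s i) * C x i))"
        by (rule sum.cong) (auto simp: G_def sum_of_real_ortho[OF fin(2) ou])
      finally show ?thesis by (simp add: G_def power2_eq_square mult_ac)
    qed
    show "coord (adjoint (fin_op F a) (fin_op F a x)) k =
      coord (\<Sum>j\<in>J. cscale (of_real ((s j)\<^sup>2) * C x j) (w j)) k"
      unfolding lhs using rhs by (cases "k \<in> F") (simp_all add: coord_w)
  qed
  have E: "x \<in> E \<longleftrightarrow> (\<Sum>j\<in>J. cscale (of_real ((s j)\<^sup>2) * C x j) (w j)) = cscale (of_real (t\<^sup>2)) x" for x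
    by (simp add: E_def singular_eigenspace_def TT scaleR_eq_cscale)
  have "w ` I \<subseteq> E"
  proof clarify
    fix i assume i: "i \<in> I"
    have "(\<Sum>j\<in>J. cscale (of_real ((s j)\<^sup>2) * C (w i) j) (w j)) = (\<Sum>j\<in>J. if j = i then cscale (of_real (t\<^sup>2)) (w i) else 0)"
      using i by (intro sum.cong) (auto simp: Cw I_def)
    then show "w i \<in> E" using i fin by (simp add: E I_def)
  qed
  moreover have "E \<subseteq> cell2.span (w ` I)"
  proof
    fix x assume "x \<in> E"
    then have eq: "(\<Sum>j\<in>J. cscale (of_real ((s j)\<^sup>2) * C x j) (w j)) = cscale (of_real (t\<^sup>2)) x"
      by (simp add: E)
    have C0: "C x i = 0" if "i \<in> J" "i \<notin> I" for i
    proof -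
      have "of_real ((s i)\<^sup>2) * C x i = (\<Sum>j\<in>J. if j = i then of_real ((s i)\<^sup>2) * C x i else 0)"
        using that fin by simp
      also have "\<dots> = (\<Sum>j\<in>J. of_real ((s j)\<^sup>2) * C x j * C (w j) i)"
        by (rule sum.cong) (use that in \<open>auto simp: Cw\<close>)
      also have "\<dots> = C (cscale (of_real (t\<^sup>2)) x) i"
        unfolding eq[symmetric] by (simp add: C_sum C_scale)
      finally have "of_real ((s i)\<^sup>2) * C x i = of_real (t\<^sup>2) * C x i" by (simp add: C_scale)
      moreover have "(s i)\<^sup>2 \<noteq> t\<^sup>2" using that pos[of i] t by (auto simp: I_def power2_eq_iff_nonneg)
      ultimately show ?thesis
        by (metis mult_cancel_right of_real_eq_iff)
    qed
    have "x = cscale (inverse (of_real (t\<^sup>2))) (cscale (of_real (t\<^sup>2)) x)" using t by simp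
    also have "cscale (of_real (t\<^sup>2)) x = (\<Sum>j\<in>I. cscale (of_real ((s j)\<^sup>2) * C x j) (w j))"
      unfolding eq[symmetric] by (rule sum.mono_neutral_right) (use fin I C0 in auto)
    finally show "x \<in> cell2.span (w ` I)"
      by (metis (no_types, lifting) cell2.span_base cell2.span_scale cell2.span_sum imageI)
  qed
  moreover have inj: "inj_on w I"
    by (rule inj_onI) (metis Cw I(2) subsetD zero_neq_one)
  moreover have "cell2.independent (w ` I)"
  proof (rule cell2.independent_if_scalars_zero)
    show "finite (w ` I)" using I by simp
    fix f x assume 0: "(\<Sum>x\<in>w ` I. cscale (f x) x) = 0" and "x \<in> w ` I"
    then obtain i where i: "i \<in> I" "x = w i" by blast
    have "0 = C (\<Sum>x\<in>w ` I. cscale (f x) x) i" unfolding 0 by (simp add: C_def)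
    also have "\<dots> = (\<Sum>j\<in>I. f (w j) * C (w j) i)" using inj by (simp add: sum.reindex C_sum C_scale)
    also have "\<dots> = (\<Sum>j\<in>I. if j = i then f (w i) else 0)"
      by (rule sum.cong) (use i I in \<open>auto simp: Cw subset_iff\<close>)
    finally show "f x = 0" using i I by simp
  qed
  ultimately have "cell2.dim E = card (w ` I)" by (metis cell2.basis_card_eq_dim)
  with inj show ?thesis by (simp add: card_image E_def I_def)
qed

text \<open>The specification of the singular values, where the dimensions of the eigenspaces are replaced by
  the multiplicities in a finite family \<open>s\<close>.\<close>

definition is_sv_seq :: "'i set \<Rightarrow> ('i \<Rightarrow> real) \<Rightarrow> (nat \<Rightarrow> real) \<Rightarrow> bool" where
  "is_sv_seq J s \<sigma> \<longleftrightarrow> antimono \<sigma> \<and> (\<forall>k. 0 \<le> \<sigma> k) \<and>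
     (\<forall>t>0. finite {k. \<sigma> k = t} \<and> card {k. \<sigma> k = t} = card {j\<in>J. s j = t})"

text \<open>The set \<open>{k. t \<le> \<sigma> k}\<close> is finite because the positive values of \<open>\<sigma>\<close> are values of \<open>s\<close>, and it is
  an initial segment of the natural numbers because \<open>\<sigma>\<close> is nonincreasing; hence its cardinality
  determines it. So all superlevel sets of \<open>\<sigma>\<close>, and thereby \<open>\<sigma>\<close> itself, depend on \<open>s\<close> only.\<close>

lemma is_sv_seq_ge_iff:
  assumes J: "finite J" and \<sigma>: "is_sv_seq J s \<sigma>" and t: "0 < t"
  shows "t \<le> \<sigma> k \<longleftrightarrow> k < card {j\<in>J. t \<le> s j}"
proof -
  let ?V = "{r\<in>s ` J. t \<le> r}"
  have fV: "finite ?V" using J by simp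
  have fin: "finite {k. \<sigma> k = r}" "card {k. \<sigma> k = r} = card {j\<in>J. s j = r}" if "0 < r" for r
    using \<sigma> that by (auto simp: is_sv_seq_def)
  have mem: "\<sigma> k \<in> s ` J" if "0 < \<sigma> k" for k
  proof -
    have "card {j. \<sigma> j = \<sigma> k} \<noteq> 0" using fin(1)[OF that] by (auto simp: card_eq_0_iff)
    then have "card {j\<in>J. s j = \<sigma> k} \<noteq> 0" using fin(2)[OF that] by simp
    show ?thesis
    proof (rule ccontr)
      assume nin: "\<sigma> k \<notin> s ` J"
      have "s j \<noteq> \<sigma> k" if "j \<in> J" for j
      proof
        assume "s j = \<sigma> k"
        with imageI[OF that, of s] nin show False by metis
      qed
      then have "{j\<in>J. s j = \<sigma> k} = {}" by blast
      with \<open>card {j\<in>J. s j = \<sigma> k} \<noteq> 0\<close> show False by simp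
    qed
  qed
  have U: "{k. t \<le> \<sigma> k} = (\<Union>r\<in>?V. {k. \<sigma> k = r})"
  proof (intro equalityI subsetI)
    fix k assume "k \<in> {k. t \<le> \<sigma> k}"
    then have "\<sigma> k \<in> ?V" using mem[of k] t by simp
    then show "k \<in> (\<Union>r\<in>?V. {k. \<sigma> k = r})" by blast
  qed auto
  have UJ: "{j\<in>J. t \<le> s j} = (\<Union>r\<in>?V. {j\<in>J. s j = r})" by auto
  have finU: "finite {k. t \<le> \<sigma> k}" unfolding U by (rule finite_UN_I[OF fV]) (use t fin(1) in simp)
  have "card {k. t \<le> \<sigma> k} = (\<Sum>r\<in>?V. card {k. \<sigma> k = r})"
    unfolding U by (rule card_UN_disjoint) (use fV t in \<open>auto intro: fin(1)\<close>)
  also have "\<dots> = (\<Sum>r\<in>?V. card {j\<in>J. s j = r})"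
    by (rule sum.cong) (use t in \<open>auto intro: fin(2)\<close>)
  also have "\<dots> = card {j\<in>J. t \<le> s j}"
    unfolding UJ by (rule card_UN_disjoint[symmetric]) (use fV J in auto)
  finally have card: "card {k. t \<le> \<sigma> k} = card {j\<in>J. t \<le> s j}" .
  have down: "i \<in> {k. t \<le> \<sigma> k}" if "j \<in> {k. t \<le> \<sigma> k}" "i \<le> j" for i j
    using antimonoD[of \<sigma> i j] \<sigma> that by (simp add: is_sv_seq_def)
  obtain N where N: "{k. t \<le> \<sigma> k} = {..<N}"
  proof (cases "{k. t \<le> \<sigma> k} = {}")
    case True
    then show ?thesis using that[of 0] by simp
  next
    case False
    have "{k. t \<le> \<sigma> k} = {..<Suc (Max {k. t \<le> \<sigma> k})}"
    proof (intro equalityI subsetI)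
      fix i assume "i \<in> {k. t \<le> \<sigma> k}"
      then show "i \<in> {..<Suc (Max {k. t \<le> \<sigma> k})}"
        using Max_ge[OF finU] by (metis less_Suc_eq_le lessThan_iff)
    next
      fix i assume "i \<in> {..<Suc (Max {k. t \<le> \<sigma> k})}"
      then show "i \<in> {k. t \<le> \<sigma> k}"
        using down[OF Max_in[OF finU False], of i] by (metis less_Suc_eq_le lessThan_iff)
    qed
    then show ?thesis by (rule that)
  qed
  then have "N = card {j\<in>J. t \<le> s j}" using card by simp
  with N show ?thesis by auto
qed

lemma is_sv_seq_unique:
  assumes "finite J" "is_sv_seq J s \<sigma>" "is_sv_seq J s \<sigma>'"
  shows "\<sigma> = \<sigma>'"
proof
  fix k
  have nn: "0 \<le> \<sigma> k" "0 \<le> \<sigma>' k" using assms by (auto simp: is_sv_seq_def)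
  have iff: "t \<le> \<sigma> k \<longleftrightarrow> t \<le> \<sigma>' k" if "0 < t" for t
    unfolding is_sv_seq_ge_iff[OF assms(1,2) that] is_sv_seq_ge_iff[OF assms(1,3) that] ..
  show "\<sigma> k = \<sigma>' k" using iff[of "\<sigma> k"] iff[of "\<sigma>' k"] nn by linarith
qed

text \<open>The sequence is the sorted family, continued by zeros; these do not contribute to the power sum
  since \<open>0 powr q = 0\<close>.\<close>

lemma is_sv_seq_exists:
  assumes J: "finite J" and pos: "\<And>j. j \<in> J \<Longrightarrow> 0 < s j"
  shows "\<exists>\<sigma>. is_sv_seq J s \<sigma> \<and> (\<lambda>k. \<sigma> k powr q) sums (\<Sum>j\<in>J. s j powr q)"
proof -
  obtain js where js: "set js = J" "distinct js" using J finite_distinct_list by blast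
  define xs where "xs = rev (sort (map s js))"
  have mset_xs: "mset xs = mset (map s js)" by (simp add: xs_def)
  have set_xs: "set xs = s ` J" using js by (simp add: xs_def)
  have nth_pos: "0 < xs ! k" if "k < length xs" for k
    using nth_mem[OF that] pos by (auto simp: set_xs)
  define \<sigma> where "\<sigma> k = (if k < length xs then xs ! k else 0)" for k
  have desc: "xs ! j \<le> xs ! i" if "i \<le> j" "j < length xs" for i j
    unfolding xs_def using that
    by (simp add: rev_nth xs_def sorted_nth_mono)
  have "antimono \<sigma>"
    by (rule antimonoI) (auto simp: \<sigma>_def desc less_imp_le nth_pos)
  moreover have "0 \<le> \<sigma> k" for k by (simp add: \<sigma>_def less_imp_le nth_pos)
  moreover have "finite {k. \<sigma> k = t} \<and> card {k. \<sigma> k = t} = card {j\<in>J. s j = t}" if "0 < t" for t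
  proof -
    have eq: "{k. \<sigma> k = t} = {k. k < length xs \<and> xs ! k = t}" using that by (auto simp: \<sigma>_def)
    have "card {k. k < length xs \<and> xs ! k = t} = length (filter (\<lambda>x. x = t) xs)"
      by (simp add: length_filter_conv_card)
    also have "\<dots> = size (filter_mset (\<lambda>x. x = t) (mset xs))" by (simp flip: mset_filter)
    also have "\<dots> = length (filter (\<lambda>j. s j = t) js)"
      by (simp add: mset_xs filter_mset_image_mset flip: mset_filter)
    also have "\<dots> = card {j\<in>J. s j = t}"
      using js by (simp add: distinct_card[symmetric])
    finally show ?thesis by (simp add: eq)
  qed
  ultimately have "is_sv_seq J s \<sigma>" by (simp add: is_sv_seq_def)
  moreover have "(\<lambda>k. \<sigma> k powr q) sums (\<Sum>k<length xs. \<sigma> k powr q)"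
    by (rule sums_finite) (auto simp: \<sigma>_def)
  moreover have "(\<Sum>k<length xs. \<sigma> k powr q) = (\<Sum>j\<in>J. s j powr q)"
  proof -
    have "(\<Sum>k<length xs. \<sigma> k powr q) = sum_list (map (\<lambda>x. x powr q) xs)"
      by (simp add: sum_list_sum_nth \<sigma>_def atLeast0LessThan)
    also have "\<dots> = sum_mset (image_mset (\<lambda>x. x powr q) (mset xs))"
      by (simp flip: sum_mset_sum_list)
    also have "\<dots> = sum_list (map (\<lambda>j. s j powr q) js)"
      unfolding mset_xs by (simp add: image_mset.compositionality comp_def flip: sum_mset_sum_list)
    also have "\<dots> = (\<Sum>j\<in>J. s j powr q)" using js by (simp add: sum_list_distinct_conv_sum_set)
    finally show ?thesis .
  qed
  ultimately show ?thesis by auto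
qed

lemma schatten_fin_op:
  assumes svd: "svd F a J s u v" and F: "0 \<notin> F"
  shows "fin_op F a \<in> schatten_class q"
    and "schatten_norm q (fin_op F a) = (\<Sum>j\<in>J. s j powr q) powr (1 / q)"
proof -
  have fin: "finite F" "finite J" and pos: "\<And>j. j \<in> J \<Longrightarrow> 0 < s j"
    using svd by (auto simp: svd_def)
  obtain \<sigma> where \<sigma>: "is_sv_seq J s \<sigma>" "(\<lambda>k. \<sigma> k powr q) sums (\<Sum>j\<in>J. s j powr q)"
    using is_sv_seq_exists[of J s q] fin pos by blast
  have "singular_values (fin_op F a) = (THE \<sigma>. is_sv_seq J s \<sigma>)"
    unfolding singular_values_def is_sv_seq_def
    by (simp add: dim_singular_eigenspace[OF svd F] cong: conj_cong)
  also have "\<dots> = \<sigma>" using \<sigma>(1) is_sv_seq_unique[OF fin(2)] by blast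
  finally have sv: "singular_values (fin_op F a) = \<sigma>" .
  show "fin_op F a \<in> schatten_class q"
    using \<sigma>(2) compact_op_fin_op[OF fin(1) F] by (simp add: schatten_class_def sv sums_iff)
  show "schatten_norm q (fin_op F a) = (\<Sum>j\<in>J. s j powr q) powr (1 / q)"
    using \<sigma>(2) by (simp add: schatten_norm_def sv sums_iff)
qed

section \<open>Power sums of singular values and tensor products\<close>

text \<open>Only the power sum of the singular values is recorded. Fixing the type of the index set makes it
  possible to quantify over the decomposition.\<close>

definition svd_sum :: "real \<Rightarrow> nat set \<Rightarrow> (nat \<Rightarrow> nat \<Rightarrow> real) \<Rightarrow> real \<Rightarrow> bool" where
  "svd_sum q F a S \<longleftrightarrow> (\<exists>(J :: nat set) s u v. svd F a J s u v \<and> S = (\<Sum>j\<in>J. s j powr q))"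

lemma svd_sumI:
  fixes J :: "'i set"
  assumes "svd F a J s u v"
  shows "svd_sum q F a (\<Sum>j\<in>J. s j powr q)"
proof -
  have "finite J" using assms by (simp add: svd_def)
  then obtain h where h: "bij_betw h {0..<card J} J" using ex_bij_betw_nat_finite by blast
  have hJ: "h i \<in> J" if "i < card J" for i using h that by (auto simp: bij_betw_def)
  have h_eq: "h i = h j \<longleftrightarrow> i = j" if "i < card J" "j < card J" for i j
    using h that by (auto simp: bij_betw_def inj_on_def)
  have re: "(\<Sum>j\<in>J. f j) = (\<Sum>i\<in>{0..<card J}. f (h i))" for f :: "'i \<Rightarrow> real"
    by (rule sum.reindex_bij_betw[OF h, symmetric])
  have "svd F a {0..<card J} (s \<circ> h) (u \<circ> h) (v \<circ> h)"
    using assms unfolding svd_def orthonormal_on_def by (simp add: re hJ h_eq)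
  then have "svd_sum q F a (\<Sum>i\<in>{0..<card J}. (s \<circ> h) i powr q)"
    unfolding svd_sum_def by blast
  then show ?thesis by (simp add: re)
qed

text \<open>Tensor products of singular vectors are singular vectors of the tensor product, here transported
  along a bijection \<open>h\<close> that enumerates pairs of indices.\<close>

lemma svd_sum_tensor:
  assumes a: "svd_sum q F a S" and b: "svd_sum q G b T"
    and h: "bij_betw h (F \<times> G) H"
    and c: "\<And>m n i j. m \<in> F \<Longrightarrow> n \<in> F \<Longrightarrow> i \<in> G \<Longrightarrow> j \<in> G \<Longrightarrow> c (h (m, i)) (h (n, j)) = a m n * b i j"
  shows "svd_sum q H c (S * T)"
proof -
  obtain J :: "nat set" and s u v where J: "svd F a J s u v" and S: "S = (\<Sum>j\<in>J. s j powr q)"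
    using a by (auto simp: svd_sum_def)
  obtain K :: "nat set" and t x y where K: "svd G b K t x y" and T: "T = (\<Sum>k\<in>K. t k powr q)"
    using b by (auto simp: svd_sum_def)
  define g where "g = inv_into (F \<times> G) h"
  define tens :: "(nat \<Rightarrow> nat \<Rightarrow> real) \<Rightarrow> (nat \<Rightarrow> nat \<Rightarrow> real) \<Rightarrow> nat \<times> nat \<Rightarrow> nat \<Rightarrow> real"
    where "tens f f' jk z = f (fst jk) (fst (g z)) * f' (snd jk) (snd (g z))" for f f' jk z
  have gh: "g (h (m, i)) = (m, i)" if "m \<in> F" "i \<in> G" for m i
    using h that unfolding g_def by (simp add: bij_betw_def)
  have tens_h: "tens f f' (j, k) (h (m, i)) = f j m * f' k i" if "m \<in> F" "i \<in> G" for f f' j k m i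
    using gh[OF that] by (simp add: tens_def)
  have ortho: "orthonormal_on H (J \<times> K) (tens f f')"
    if "orthonormal_on F J f" "orthonormal_on G K f'" for f f'
  proof -
    have "(\<Sum>z\<in>H. tens f f' (j, k) z * tens f f' (j', k') z) = (if (j, k) = (j', k') then 1 else 0)"
      if jk: "j \<in> J" "k \<in> K" "j' \<in> J" "k' \<in> K" for j k j' k'
    proof -
      have "(\<Sum>z\<in>H. tens f f' (j, k) z * tens f f' (j', k') z)
          = (\<Sum>p\<in>F \<times> G. tens f f' (j, k) (h p) * tens f f' (j', k') (h p))"
        by (rule sum.reindex_bij_betw[OF h, symmetric])
      also have "\<dots> = (\<Sum>(m, i)\<in>F \<times> G. (f j m * f j' m) * (f' k i * f' k' i))"
        by (rule sum.cong) (auto simp: tens_h)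
      also have "\<dots> = (\<Sum>m\<in>F. f j m * f j' m) * (\<Sum>i\<in>G. f' k i * f' k' i)"
        by (simp add: sum_product sum.cartesian_product)
      also have "\<dots> = (if (j, k) = (j', k') then 1 else 0)"
        using that jk \<open>orthonormal_on F J f\<close> \<open>orthonormal_on G K f'\<close>
        by (simp add: orthonormal_on_def)
      finally show ?thesis .
    qed
    then show ?thesis by (auto simp: orthonormal_on_def)
  qed
  have "svd H c (J \<times> K) (\<lambda>(j, k). s j * t k) (tens u x) (tens v y)"
    unfolding svd_def
  proof (intro conjI ballI)
    show "finite H" using h J K by (metis bij_betw_finite finite_cartesian_product svd_def)
    show "finite (J \<times> K)" using J K by (simp add: svd_def)
    show "0 < (case p of (j, k) \<Rightarrow> s j * t k)" if "p \<in> J \<times> K" for p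
      using J K that by (auto simp: svd_def)
    show "orthonormal_on H (J \<times> K) (tens u x)" "orthonormal_on H (J \<times> K) (tens v y)"
      using J K by (auto simp: svd_def intro: ortho)
    fix z w assume "z \<in> H" "w \<in> H"
    then obtain m i n j where z: "z = h (m, i)" "w = h (n, j)" and mem: "m \<in> F" "n \<in> F" "i \<in> G" "j \<in> G"
      using h by (force simp: bij_betw_def)
    have "c z w = (\<Sum>l\<in>J. s l * u l m * v l n) * (\<Sum>k\<in>K. t k * x k i * y k j)"
      unfolding z using J K mem by (simp add: c svd_def)
    also have "\<dots> = (\<Sum>(l, k)\<in>J \<times> K. (s l * t k) * (u l m * x k i) * (v l n * y k j))"
      unfolding sum_product sum.cartesian_product by (rule sum.cong) (auto simp: mult_ac)
    also have "\<dots> = (\<Sum>p\<in>J \<times> K. (case p of (l, k) \<Rightarrow> s l * t k) * tens u x p z * tens v y p w)"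
      unfolding z by (rule sum.cong) (auto simp: tens_h mem)
    finally show "c z w = (\<Sum>p\<in>J \<times> K. (case p of (l, k) \<Rightarrow> s l * t k) * tens u x p z * tens v y p w)" .
  qed
  from svd_sumI[OF this, of q]
  have "svd_sum q H c (\<Sum>p\<in>J \<times> K. (case p of (j, k) \<Rightarrow> s j * t k) powr q)" .
  moreover have "(\<Sum>p\<in>J \<times> K. (case p of (j, k) \<Rightarrow> s j * t k) powr q) = S * T"
    unfolding S T sum_product sum.cartesian_product
    by (rule sum.cong) (use J K in \<open>auto simp: svd_def powr_mult less_imp_le\<close>)
  ultimately show ?thesis by simp
qed

section \<open>Amplification at a single prime\<close>

lemma svd_antidiagonal:
  assumes "J \<subseteq> {..2}" "0 < c"
  shows "svd {..2} (\<lambda>i j. if i \<in> J \<and> i + j = 2 then c else 0) J (\<lambda>_. c)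
    (\<lambda>j n. if n = j then 1 else 0) (\<lambda>j n. if n + j = 2 then 1 else 0)"
proof -
  have fin: "finite J" using assms finite_subset by blast
  have s3: "(\<Sum>n\<in>{..2::nat}. f n) = f 0 + f 1 + f 2" for f :: "nat \<Rightarrow> real"
    by (simp add: numeral_2_eq_2)
  have u: "(\<Sum>n\<le>2. (if n = i then 1 else 0) * (if n = j then 1 else 0)) = (if i = j then 1 else (0::real))"
    if "i \<le> 2" "j \<le> 2" for i j :: nat
    using that by (auto simp: s3)
  have v: "(\<Sum>n\<le>2. (if n + i = 2 then 1 else 0) * (if n + j = 2 then 1 else 0)) = (if i = j then 1 else (0::real))"
    if "i \<le> 2" "j \<le> 2" for i j :: nat
    using that by (auto simp: s3)
  have "(\<Sum>j\<in>J. c * (if m = j then 1 else 0) * (if n + j = 2 then 1 else 0))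
     = (\<Sum>j\<in>J. if j = m then (if m + n = 2 then c else 0) else 0)" for m n
    by (rule sum.cong) auto
  then have a: "(\<Sum>j\<in>J. c * (if m = j then 1 else 0) * (if n + j = 2 then 1 else 0))
     = (if m \<in> J \<and> m + n = 2 then c else 0)" for m n
    using fin by simp
  show ?thesis
    unfolding svd_def orthonormal_on_def a
    using assms fin u v by (auto simp: subset_iff)
qed

text \<open>A rotation of the plane of the two rows makes them orthogonal without changing the Gram
  determinant and the sum of the squared lengths. The squared lengths \<open>x\<close>, \<open>y\<close> of the rotated rows
  are the squared singular values.\<close>

lemma svd_sum_two_rows:
  fixes r1 r2 :: "nat \<Rightarrow> real" and a :: "nat \<Rightarrow> nat \<Rightarrow> real"
  defines "R1 \<equiv> \<Sum>n\<le>2. r1 n * r1 n" and "R2 \<equiv> \<Sum>n\<le>2. r2 n * r2 n" and "G \<equiv> \<Sum>n\<le>2. r1 n * r2 n"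
  assumes a: "\<And>n. n \<le> 2 \<Longrightarrow> a 0 n = r1 n" "\<And>n. n \<le> 2 \<Longrightarrow> a 1 n = r2 n" "\<And>n. n \<le> 2 \<Longrightarrow> a 2 n = 0"
    and pos: "0 < R1 * R2 - G\<^sup>2"
  shows "\<exists>x y. 0 < x \<and> 0 < y \<and> x + y = R1 + R2 \<and> x * y = R1 * R2 - G\<^sup>2 \<and>
    svd_sum q {..2} a (x powr (q / 2) + y powr (q / 2))"
proof -
  \<comment> \<open>In polar form, twice the required rotation angle can be read off.\<close>
  obtain \<rho> t where t: "R1 - R2 = \<rho> * cos t" "2 * G = \<rho> * sin t" using polar_Ex by blast
  define c s where "c = cos (t / 2)" and "s = sin (t / 2)"
  have cs: "c * c + s * s = 1" using sin_cos_squared_add3 c_def s_def by blast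
  have t': "R1 - R2 = \<rho> * (c * c - s * s)" "G = \<rho> * (s * c)"
    using t cos_double[of "t/2"] sin_double[of "t/2"] by (auto simp: c_def s_def power2_eq_square)
  define w1 w2 where "w1 n = c * r1 n + s * r2 n" and "w2 n = c * r2 n - s * r1 n" for n
  define W1 W2 where "W1 = (\<Sum>n\<le>2. w1 n * w1 n)" and "W2 = (\<Sum>n\<le>2. w2 n * w2 n)"
  have W1: "W1 = c * c * R1 + 2 * (c * s * G) + s * s * R2"
    unfolding W1_def w1_def R1_def R2_def G_def
    by (simp add: algebra_simps sum.distrib sum_distrib_left)
  have W2: "W2 = c * c * R2 - 2 * (c * s * G) + s * s * R1"
    unfolding W2_def w2_def R1_def R2_def G_def
    by (simp add: algebra_simps sum.distrib sum_subtractf sum_distrib_left)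
  have "(\<Sum>n\<le>2. w1 n * w2 n) = (c * c - s * s) * G - c * s * (R1 - R2)"
    unfolding w1_def w2_def R1_def R2_def G_def
    by (simp add: algebra_simps sum.distrib sum_subtractf sum_distrib_left)
  also have "\<dots> = 0" unfolding t' by (simp add: algebra_simps)
  finally have orth: "(\<Sum>n\<le>2. w1 n * w2 n) = 0" .
  have "W1 + W2 = (c * c + s * s) * (R1 + R2)" unfolding W1 W2 by (simp add: algebra_simps)
  then have sum: "W1 + W2 = R1 + R2" using cs by simp
  \<comment> \<open>The Gram determinant is invariant under rotation.\<close>
  have "W1 * W2 - (\<Sum>n\<le>2. w1 n * w2 n)\<^sup>2 = (c * c + s * s)\<^sup>2 * (R1 * R2 - G\<^sup>2)"
    unfolding W1 W2 \<open>(\<Sum>n\<le>2. w1 n * w2 n) = (c * c - s * s) * G - c * s * (R1 - R2)\<close>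
    by (simp add: algebra_simps power2_eq_square)
  then have prod: "W1 * W2 = R1 * R2 - G\<^sup>2" using orth cs by simp
  have "0 \<le> W1" "0 \<le> W2" by (auto simp: W1_def W2_def intro: sum_nonneg)
  moreover have "W1 \<noteq> 0" "W2 \<noteq> 0" using pos prod by auto
  ultimately have Wpos: "0 < W1" "0 < W2" by auto
  define \<sigma> where "\<sigma> j = (if j = 0 then sqrt W1 else sqrt W2)" for j :: nat
  define u where "u j n = (if j = 0 then (if n = 0 then c else if n = 1 then s else 0)
    else (if n = 0 then - s else if n = 1 then c else 0))" for j n :: nat
  define v where "v j n = (if j = 0 then w1 n / sqrt W1 else w2 n / sqrt W2)" for j n :: nat
  have "svd {..2} a {0, 1} \<sigma> u v"
    unfolding svd_def
  proof (intro conjI)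
    show "orthonormal_on {..2} {0, 1} u"
      using cs by (simp add: orthonormal_on_def u_def numeral_2_eq_2)
    have normalise: "(\<Sum>n\<le>2. f n / A * (f' n / B)) = (\<Sum>n\<le>2. f n * f' n) / (A * B)"
      for f f' :: "nat \<Rightarrow> real" and A B
      by (simp add: sum_divide_distrib)
    have "(\<Sum>n\<le>2. w1 n / sqrt W1 * (w1 n / sqrt W1)) = 1"
      "(\<Sum>n\<le>2. w2 n / sqrt W2 * (w2 n / sqrt W2)) = 1"
      "(\<Sum>n\<le>2. w1 n / sqrt W1 * (w2 n / sqrt W2)) = 0"
      unfolding normalise orth W1_def[symmetric] W2_def[symmetric] using Wpos by simp_all
    then show "orthonormal_on {..2} {0, 1} v"
      using Wpos by (simp add: orthonormal_on_def v_def mult.commute)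
    have r: "r1 n = c * w1 n - s * w2 n" "r2 n = s * w1 n + c * w2 n" for n
    proof -
      have "c * w1 n - s * w2 n = (c * c + s * s) * r1 n" "s * w1 n + c * w2 n = (c * c + s * s) * r2 n"
        by (simp_all add: w1_def w2_def algebra_simps)
      then show "r1 n = c * w1 n - s * w2 n" "r2 n = s * w1 n + c * w2 n" using cs by simp_all
    qed
    show "\<forall>m\<in>{..2}. \<forall>n\<in>{..2}. a m n = (\<Sum>j\<in>{0, 1}. \<sigma> j * u j m * v j n)"
    proof (intro ballI)
      fix m n :: nat assume "m \<in> {..2}" "n \<in> {..2}"
      then have "m = 0 \<or> m = 1 \<or> m = 2" "n \<le> 2" by auto
      then show "a m n = (\<Sum>j\<in>{0, 1}. \<sigma> j * u j m * v j n)"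
        using a Wpos r[of n] by (auto simp: \<sigma>_def u_def v_def)
    qed
  qed (use Wpos in \<open>auto simp: \<sigma>_def\<close>)
  from svd_sumI[OF this, of q]
  have "svd_sum q {..2} a (W1 powr (q / 2) + W2 powr (q / 2))"
    using Wpos by (simp add: \<sigma>_def powr_half_sqrt[symmetric] powr_powr)
  then show ?thesis using Wpos sum prod by blast
qed

lemma powr_above_tangent:
  fixes p x t :: real
  assumes "1 \<le> p" "0 < x" "0 < t"
  shows "t powr p + p * t powr (p - 1) * (x - t) \<le> x powr p"
proof -
  have "p * t powr (p - 1) * (x - t) \<le> x powr p - t powr p"
  proof (rule convex_on_imp_above_tangent[where A = "{0<..}"])
    show "convex_on {0<..} (\<lambda>x. x powr p)"
      by (rule powr_convex) (use assms in auto)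
    show "((\<lambda>x. x powr p) has_field_derivative p * t powr (p - 1)) (at t within {0<..})"
      using assms by (auto intro!: derivative_eq_intros)
  qed (use assms in \<open>auto simp: interior_open\<close>)
  then show ?thesis by simp
qed

text \<open>This is the convex case for the inverse function \<open>x powr (1 / p)\<close>, solved for \<open>x powr p\<close>.\<close>

lemma powr_below_tangent:
  fixes p x t :: real
  assumes "0 < p" "p \<le> 1" "0 < x" "0 < t"
  shows "x powr p \<le> t powr p + p * t powr (p - 1) * (x - t)"
proof -
  have "1 \<le> 1 / p" using assms by (simp add: field_simps)
  from powr_above_tangent[OF this, of "x powr p" "t powr p"]
  have "t + (1 / p) * t powr (1 - p) * (x powr p - t powr p) \<le> x"
    using assms by (simp add: powr_powr algebra_simps)
  then have "(x powr p - t powr p) * t powr (1 - p) \<le> p * (x - t)"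
    using assms by (simp add: field_simps)
  then have "(x powr p - t powr p) * t powr (1 - p) * t powr (p - 1) \<le> p * (x - t) * t powr (p - 1)"
    by (intro mult_right_mono) auto
  moreover have "t powr (1 - p) * t powr (p - 1) = 1"
    using assms by (simp flip: powr_add)
  ultimately show ?thesis by (simp add: mult.assoc) (simp add: mult_ac)
qed

text \<open>The numbers \<open>x\<close>, \<open>y\<close> stand for the squared singular values of
  \<open>[[1, \<surd>2, -r\<epsilon>], [\<surd>2, \<epsilon>, 0], [0, 0, 0]]\<close> with \<open>c = r\<^sup>2\<close>; for \<open>\<epsilon> = 0\<close> they are 4 and 1. To first order
  in \<open>\<epsilon>\<close> their sum does not change and their product changes by \<open>-4\<epsilon>\<close>, so the smaller one moves by
  about \<open>-4\<epsilon>/3\<close> and the larger one by the opposite amount. As \<open>x powr p\<close> has a smaller slope at 4 than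
  at 1 for \<open>p < 1\<close> and a larger one for \<open>p > 1\<close>, the power sum decreases if \<open>\<epsilon>\<close> is positive in the
  first case and negative in the second. The bound \<open>L\<close> on \<open>c\<close> makes the gain \<open>g\<close> uniform in \<open>c\<close>.\<close>

lemma perturbed_power_sum_less:
  fixes p L :: real
  assumes p: "0 < p" "p \<noteq> 1" and L: "0 \<le> L"
  obtains \<epsilon> g where "\<bar>\<epsilon>\<bar> \<le> 1" "0 < g"
    "\<And>c x y. \<lbrakk>0 \<le> c; c \<le> L; 0 < x; 0 < y; x + y = 5 + (1 + c) * \<epsilon>\<^sup>2;
       x * y = (\<epsilon> - 2)\<^sup>2 + 2 * c * \<epsilon>\<^sup>2 + c * \<epsilon> ^ 4\<rbrakk> \<Longrightarrow> x powr p + y powr p \<le> 4 powr p + 1 - g"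
proof -
  note witness = that
  define M where "M = 1 + 3 * L"
  have M: "1 \<le> M" using L by (simp add: M_def)
  \<comment> \<open>It suffices to treat the larger root \<open>x\<close> and the smaller root \<open>y\<close>, with all second-order terms
    bounded by \<open>M * \<epsilon>\<^sup>2\<close>.\<close>
  have sym: thesis if \<epsilon>: "\<bar>\<epsilon>\<bar> \<le> 1" and g: "0 < g" and
    *: "\<And>x y \<tau>. \<lbrakk>0 < y; y \<le> x; x + y = 5 + \<tau>; 0 \<le> \<tau>; \<tau> \<le> M * \<epsilon>\<^sup>2; - 4 * \<epsilon> \<le> x * y - 4; x * y - 4 \<le> - 4 * \<epsilon> + M * \<epsilon>\<^sup>2\<rbrakk>
       \<Longrightarrow> x powr p + y powr p \<le> 4 powr p + 1 - g" for \<epsilon> g :: real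
  proof -
    have e2: "\<epsilon>\<^sup>2 \<le> 1" using \<epsilon> by (simp add: abs_square_le_1)
    have main: "x powr p + y powr p \<le> 4 powr p + 1 - g" if
      h: "0 \<le> c" "c \<le> L" "0 < x" "0 < y" "x + y = 5 + (1 + c) * \<epsilon>\<^sup>2"
       "x * y = (\<epsilon> - 2)\<^sup>2 + 2 * c * \<epsilon>\<^sup>2 + c * \<epsilon> ^ 4" "y \<le> x" for c x y :: real
    proof (rule *[of y x "(1 + c) * \<epsilon>\<^sup>2"])
      show "(1 + c) * \<epsilon>\<^sup>2 \<le> M * \<epsilon>\<^sup>2"
        by (rule mult_right_mono) (use h L in \<open>auto simp: M_def\<close>)
      have q4: "\<epsilon> ^ 4 = \<epsilon>\<^sup>2 * \<epsilon>\<^sup>2" by (simp add: power2_eq_square power4_eq_xxxx)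
      have d: "x * y - 4 = - 4 * \<epsilon> + (1 + 2 * c + c * \<epsilon>\<^sup>2) * \<epsilon>\<^sup>2"
        using h(6) unfolding q4 by (simp add: power2_eq_square algebra_simps)
      have "0 \<le> (1 + 2 * c + c * \<epsilon>\<^sup>2) * \<epsilon>\<^sup>2" using h by simp
      with d show "- 4 * \<epsilon> \<le> x * y - 4" by linarith
      have "c * \<epsilon>\<^sup>2 \<le> c" using h e2 by (simp add: mult_left_le)
      then have "(1 + 2 * c + c * \<epsilon>\<^sup>2) * \<epsilon>\<^sup>2 \<le> M * \<epsilon>\<^sup>2"
        using h by (intro mult_right_mono) (auto simp: M_def)
      with d show "x * y - 4 \<le> - 4 * \<epsilon> + M * \<epsilon>\<^sup>2" by linarith
    qed (use h in auto)
    have all: "x powr p + y powr p \<le> 4 powr p + 1 - g" if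
      h: "0 \<le> c" "c \<le> L" "0 < x" "0 < y" "x + y = 5 + (1 + c) * \<epsilon>\<^sup>2"
       "x * y = (\<epsilon> - 2)\<^sup>2 + 2 * c * \<epsilon>\<^sup>2 + c * \<epsilon> ^ 4" for c x y :: real
    proof (cases "y \<le> x")
      case True
      then show ?thesis using main h by blast
    next
      case False
      then show ?thesis using main[of c y x] h by (simp add: add.commute mult.commute)
    qed
    show thesis by (rule witness[OF \<epsilon> g]) (rule all)
  qed
  show thesis
  proof (cases "p < 1")
    case True
    define \<kappa> where "\<kappa> = 1 - (4::real) powr (p - 1)"
    have \<kappa>: "0 < \<kappa>" "\<kappa> \<le> 1" using True by (auto simp: \<kappa>_def powr_less_one)
    \<comment> \<open>The second-order terms then cost at most \<open>\<kappa> * e / 4\<close>, against a first-order gain of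
      at least \<open>3 / 4 * \<kappa> * e\<close>.\<close>
    define e where "e = \<kappa> / (4 * M)"
    have e: "0 < e" "e \<le> 1/4" "M * e = \<kappa> / 4" using \<kappa> M by (auto simp: e_def field_simps)
    have Me2: "M * e\<^sup>2 = \<kappa> / 4 * e" using e by (simp add: power2_eq_square)
    have ke: "\<kappa> * e \<le> e" "0 < \<kappa> * e" using \<kappa> e by (auto simp: mult_le_cancel_right1)
    show thesis
    proof (rule sym[of e "p * (\<kappa> * e / 2)"])
      fix x y \<tau> :: real
      assume h: "0 < y" "y \<le> x" "x + y = 5 + \<tau>" "0 \<le> \<tau>" "\<tau> \<le> M * e\<^sup>2" "x * y - 4 \<le> - 4 * e + M * e\<^sup>2"
      have x: "x = 5 + \<tau> - y" using h by simp
      have y3: "y \<le> 3" using h e ke Me2 by linarith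
      have eq: "(y - 1) * (4 - y) = x * y - 4 - \<tau> * y" unfolding x by (simp add: algebra_simps)
      have "0 \<le> \<tau> * y" using h by simp
      then have le: "(y - 1) * (4 - y) \<le> - 3 * e" using eq h Me2 ke by linarith
      have "y < 1"
      proof (rule ccontr)
        assume "\<not> y < 1"
        then have "0 \<le> (y - 1) * (4 - y)" using y3 by simp
        with le e show False by linarith
      qed
      have "(1 - y) * (4 - y) \<le> (1 - y) * 4" using \<open>y < 1\<close> h by (intro mult_left_mono) auto
      with le have y1: "y - 1 \<le> - (3/4) * e" by (simp add: algebra_simps)
      have "x powr p \<le> 4 powr p + p * 4 powr (p - 1) * (x - 4)"
        "y powr p \<le> 1 powr p + p * 1 powr (p - 1) * (y - 1)"
        by (rule powr_below_tangent; use True p h in auto)+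
      then have "x powr p + y powr p \<le> 4 powr p + 1 + p * ((1 - \<kappa>) * (x - 4) + (y - 1))"
        by (simp add: \<kappa>_def algebra_simps)
      also have "(1 - \<kappa>) * (x - 4) + (y - 1) = (1 - \<kappa>) * \<tau> + \<kappa> * (y - 1)"
        unfolding x by (simp add: algebra_simps)
      also have "p * \<dots> \<le> p * (- (\<kappa> * e / 2))"
      proof (rule mult_left_mono)
        have "(1 - \<kappa>) * \<tau> \<le> \<tau>" using \<kappa> h by (simp add: algebra_simps)
        moreover have "\<kappa> * (y - 1) \<le> \<kappa> * (- (3/4) * e)"
          using \<kappa> y1 by (intro mult_left_mono) auto
        ultimately show "(1 - \<kappa>) * \<tau> + \<kappa> * (y - 1) \<le> - (\<kappa> * e / 2)"
          using h Me2 by linarith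
      qed (use p in auto)
      finally show "x powr p + y powr p \<le> 4 powr p + 1 - p * (\<kappa> * e / 2)" by simp
    qed (use e \<kappa> p in auto)
  next
    case False
    then have p1: "1 < p" using p by auto
    define b where "b = (3::real) powr (p - 1)"
    define \<kappa> where "\<kappa> = b - (2::real) powr (p - 1)"
    have b: "1 \<le> b" using p1 by (auto simp: b_def ge_one_powr_ge_zero)
    have \<kappa>: "0 < \<kappa>" "\<kappa> \<le> b" using p1 by (auto simp: \<kappa>_def b_def powr_less_mono2)
    \<comment> \<open>The second-order terms then cost at most \<open>\<kappa> * e / 6\<close>, against a first-order gain of
      at least \<open>\<kappa> * e / 3\<close>.\<close>
    define e where "e = \<kappa> / (6 * M * b)"
    have bMe: "b * (M * e) = \<kappa> / 6" using b M by (auto simp: e_def)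
    have e0: "0 < e" using \<kappa> M b by (auto simp: e_def)
    have Me: "M * e \<le> 1/6" using bMe \<kappa> b
      by (simp add: e_def field_simps)
    have e1: "e \<le> 1/6" using Me M e0 mult_right_mono[of 1 M e] by linarith
    have Me2: "M * e\<^sup>2 \<le> e / 6" using mult_right_mono[OF Me, of e] e0 by (simp add: power2_eq_square)
    show thesis
    proof (rule sym[of "- e" "p * (\<kappa> * e / 6)"])
      fix x y \<tau> :: real
      assume "0 < y" "y \<le> x" "x + y = 5 + \<tau>" "0 \<le> \<tau>" "\<tau> \<le> M * (- e)\<^sup>2"
        "- 4 * (- e) \<le> x * y - 4" "x * y - 4 \<le> - 4 * (- e) + M * (- e)\<^sup>2"
      then have h: "0 < y" "y \<le> x" "x + y = 5 + \<tau>" "0 \<le> \<tau>" "\<tau> \<le> M * e\<^sup>2"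
        "4 * e \<le> x * y - 4" "x * y - 4 \<le> 4 * e + M * e\<^sup>2" by auto
      have x: "x = 5 + \<tau> - y" using h by simp
      have y3: "y < 3" using h e1 Me2 by linarith
      have eq: "(y - 1) * (4 - y) = x * y - 4 - \<tau> * y" unfolding x by (simp add: algebra_simps)
      have "\<tau> * y \<le> \<tau> * 3" using h y3 by (intro mult_left_mono) auto
      then have ge: "e \<le> (y - 1) * (4 - y)" using eq h Me2 by linarith
      have "0 \<le> \<tau> * y" using h by simp
      then have le: "(y - 1) * (4 - y) \<le> 5 * e" using eq h Me2 e0 by linarith
      have y1: "1 < y"
      proof (rule ccontr)
        assume "\<not> 1 < y"
        then have "0 \<le> (1 - y) * (4 - y)" using h by simp
        then have "(y - 1) * (4 - y) \<le> 0" by (simp add: algebra_simps)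
        with ge e0 show False by linarith
      qed
      have "(y - 1) * (4 - y) \<le> (y - 1) * 3" using y1 by (intro mult_left_mono) auto
      with ge have d: "e / 3 \<le> y - 1" by simp
      have "(y - 1) * 1 \<le> (y - 1) * (4 - y)" using y1 y3 by (intro mult_left_mono) auto
      with le e1 have y2: "y \<le> 2" by simp
      have x3: "3 \<le> x" using x y2 h by simp
      \<comment> \<open>For a convex power an upper bound at \<open>x\<close> and \<open>y\<close> comes from the tangents at \<open>x\<close> and \<open>y\<close>; as
        \<open>y \<le> 2\<close> and \<open>3 \<le> x\<close>, their slopes stay apart.\<close>
      have "4 powr p \<ge> x powr p + p * x powr (p - 1) * (4 - x)"
        "1 powr p \<ge> y powr p + p * y powr (p - 1) * (1 - y)"
        by (rule powr_above_tangent; use p1 h in auto)+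
      then have "x powr p + y powr p \<le> 4 powr p + 1 + p * (x powr (p - 1) * (x - 4) + y powr (p - 1) * (y - 1))"
        by (simp add: algebra_simps)
      also have "p * (x powr (p - 1) * (x - 4) + y powr (p - 1) * (y - 1)) \<le> p * (- (\<kappa> * e / 6))"
      proof (rule mult_left_mono)
        have "x - 4 \<le> 0" using x d h Me2 e0 by linarith
        moreover have "b \<le> x powr (p - 1)" unfolding b_def using x3 p1 by (intro powr_mono2) auto
        ultimately have "x powr (p - 1) * (x - 4) \<le> b * (x - 4)"
          by (intro mult_right_mono_neg) auto
        moreover have "y powr (p - 1) \<le> b - \<kappa>" unfolding \<kappa>_def using y2 y1 p1
          by (simp add: powr_mono2)
        then have "y powr (p - 1) * (y - 1) \<le> (b - \<kappa>) * (y - 1)"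
          using y1 by (intro mult_right_mono) auto
        moreover have "b * (x - 4) + (b - \<kappa>) * (y - 1) = b * \<tau> - \<kappa> * (y - 1)"
          unfolding x by (simp add: algebra_simps)
        moreover have "b * \<tau> \<le> b * (M * e\<^sup>2)" using b h by (intro mult_left_mono) auto
        moreover have "b * (M * e\<^sup>2) = \<kappa> * e / 6" using bMe by (simp add: power2_eq_square algebra_simps)
        moreover have "\<kappa> * (e / 3) \<le> \<kappa> * (y - 1)" using d \<kappa> by (intro mult_left_mono) auto
        ultimately show "x powr (p - 1) * (x - 4) + y powr (p - 1) * (y - 1) \<le> - (\<kappa> * e / 6)"
          by linarith
      qed (use p in auto)
      finally show "x powr p + y powr p \<le> 4 powr p + 1 - p * (\<kappa> * e / 6)" by simp
    qed (use e0 e1 \<kappa> p in auto)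
  qed
qed

text \<open>The local counterpart of the weighted projection, for exponents of a single prime.\<close>

definition antidiag_sum :: "(nat \<Rightarrow> nat \<Rightarrow> real) \<Rightarrow> (nat \<Rightarrow> nat \<Rightarrow> real) \<Rightarrow> nat \<Rightarrow> real" where
  "antidiag_sum \<phi> \<alpha> e = (\<Sum>i\<le>e. \<phi> i (e - i) * \<alpha> i (e - i))"

text \<open>Since \<open>\<alpha>\<close> lives on \<open>i + j \<le> 2\<close>, its antidiagonal sums vanish beyond 2, and the product of the two
  indices of an entry contributed by the prime \<open>p\<close> divides \<open>p\<^sup>2\<close>.\<close>

definition locally_amplifies :: "real \<Rightarrow> (nat \<Rightarrow> nat \<Rightarrow> real) \<Rightarrow> real \<Rightarrow> bool" where
  "locally_amplifies q \<phi> r \<longleftrightarrow> (\<exists>\<alpha> T T'. (\<forall>i j. 2 < i + j \<longrightarrow> \<alpha> i j = 0) \<and> svd_sum q {..2} \<alpha> T \<and>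
     svd_sum q {..2} (\<lambda>i j. antidiag_sum \<phi> \<alpha> (i + j)) T' \<and> 0 < T \<and> r * T \<le> T')"

text \<open>If \<open>\<phi> 0 2\<close> is below a threshold \<open>\<eta>\<close>, a matrix on the antidiagonal \<open>i + j = 2\<close> gains the factor 9/8.
  Otherwise the perturbed matrix with \<open>r = \<phi> 1 1 / \<phi> 0 2\<close> is used; then \<open>r \<le> 1 / \<eta>\<close>, which is the bound
  that makes its gain uniform.\<close>

lemma uniform_local_amplification:
  assumes q: "1 \<le> q" "q \<noteq> 2"
  shows "\<exists>R>1. \<forall>\<phi>. (\<forall>i j. 0 \<le> \<phi> i j) \<and> \<phi> 0 0 = 1 \<and> \<phi> 0 1 + \<phi> 1 0 = 1 \<and>
    \<phi> 0 2 + \<phi> 1 1 + \<phi> 2 0 = 1 \<longrightarrow> locally_amplifies q \<phi> R"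
proof -
  \<comment> \<open>Below this threshold \<open>\<rho> powr q \<ge> 3/4\<close> for \<open>\<rho> = 1 - \<phi> 0 2\<close>, so the first test matrix has power sum
    2 and its projection at least \<open>3 * (3/4) = 9/8 * 2\<close>.\<close>
  define \<eta> where "\<eta> = 1 - (3/4::real) powr (1 / q)"
  have \<eta>: "0 < \<eta>" using powr_less_mono2[of "1 / q" "3/4" 1] q by (simp add: \<eta>_def)
  define V where "V = (4::real) powr (q / 2) + 1"
  have V: "0 < V" by (simp add: V_def add_pos_nonneg)
  have "0 < q / 2" "q / 2 \<noteq> 1" "0 \<le> (1 / \<eta>)\<^sup>2" using q by auto
  note perturbed = perturbed_power_sum_less[OF this, folded V_def]
  obtain \<epsilon> g where \<epsilon>: "\<bar>\<epsilon>\<bar> \<le> 1" and g: "0 < g" and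
    gain: "\<And>c x y. \<lbrakk>0 \<le> c; c \<le> (1 / \<eta>)\<^sup>2; 0 < x; 0 < y; x + y = 5 + (1 + c) * \<epsilon>\<^sup>2;
       x * y = (\<epsilon> - 2)\<^sup>2 + 2 * c * \<epsilon>\<^sup>2 + c * \<epsilon> ^ 4\<rbrakk> \<Longrightarrow> x powr (q / 2) + y powr (q / 2) \<le> V - g"
    by (rule perturbed) (rule that; assumption?; blast)
  have antidiag: "antidiag_sum \<phi> \<alpha> 0 = \<phi> 0 0 * \<alpha> 0 0"
    "antidiag_sum \<phi> \<alpha> 1 = \<phi> 0 1 * \<alpha> 0 1 + \<phi> 1 0 * \<alpha> 1 0"
    "antidiag_sum \<phi> \<alpha> 2 = \<phi> 0 2 * \<alpha> 0 2 + \<phi> 1 1 * \<alpha> 1 1 + \<phi> 2 0 * \<alpha> 2 0" for \<phi> \<alpha>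
    by (simp_all add: antidiag_sum_def numeral_2_eq_2)
  have antidiag_big: "antidiag_sum \<phi> \<alpha> e = 0" if "\<And>i j. 2 < i + j \<Longrightarrow> \<alpha> i j = 0" "2 < e" for \<phi> \<alpha> e
    unfolding antidiag_sum_def
  proof (rule sum.neutral, rule ballI)
    fix i assume "i \<in> {..e}"
    then have "2 < i + (e - i)" using that(2) by simp
    then show "\<phi> i (e - i) * \<alpha> i (e - i) = 0" using that(1) by simp
  qed
  show ?thesis
  proof (intro exI[of _ "min (9/8) (1 + g / V)"] conjI allI impI)
    show "1 < min (9/8) (1 + g / V)" using g V by simp
    fix \<phi> :: "nat \<Rightarrow> nat \<Rightarrow> real"
    assume "(\<forall>i j. 0 \<le> \<phi> i j) \<and> \<phi> 0 0 = 1 \<and> \<phi> 0 1 + \<phi> 1 0 = 1 \<and> \<phi> 0 2 + \<phi> 1 1 + \<phi> 2 0 = 1"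
    then have nn: "\<And>i j. 0 \<le> \<phi> i j" and \<phi>: "\<phi> 0 0 = 1" "\<phi> 0 1 + \<phi> 1 0 = 1" "\<phi> 0 2 + \<phi> 1 1 + \<phi> 2 0 = 1"
      by blast+
    show "locally_amplifies q \<phi> (min (9/8) (1 + g / V))"
    proof (cases "\<phi> 0 2 < \<eta>")
      case True
      define \<alpha> where "\<alpha> i j = (if i \<in> {1, 2} \<and> i + j = 2 then 1 else (0::real))" for i j :: nat
      define \<rho> where "\<rho> = \<phi> 1 1 + \<phi> 2 0"
      have "(3/4) powr (1 / q) \<le> \<rho>" using True \<phi>(3) by (simp add: \<rho>_def \<eta>_def)
      then have "((3/4) powr (1 / q)) powr q \<le> \<rho> powr q" using q by (intro powr_mono2) auto
      then have \<rho>q: "3/4 \<le> \<rho> powr q" using q by (simp add: powr_powr)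
      have "0 < (3/4::real) powr (1 / q)" by simp
      then have \<rho>: "0 < \<rho>" using \<open>(3/4) powr (1 / q) \<le> \<rho>\<close> by linarith
      have e: "antidiag_sum \<phi> \<alpha> (i + j) = (if i \<in> {..2} \<and> i + j = 2 then \<rho> else 0)" for i j
      proof -
        consider "i + j = 0" | "i + j = 1" | "i + j = 2" | "2 < i + j" by linarith
        then show ?thesis
        proof cases
          case 3
          then have "i \<le> 2" by simp
          then show ?thesis unfolding 3 antidiag by (simp add: \<alpha>_def \<rho>_def)
        next
          case 4
          moreover have "antidiag_sum \<phi> \<alpha> (i + j) = 0"
            by (rule antidiag_big[OF _ 4]) (auto simp: \<alpha>_def)
          ultimately show ?thesis using 4 by auto
        next
          case 1
          then show ?thesis unfolding 1 antidiag by (simp add: \<alpha>_def)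
        next
          case 2
          then show ?thesis unfolding 2 antidiag by (simp add: \<alpha>_def)
        qed
      qed
      have "svd_sum q {..2} \<alpha> 2"
        using svd_sumI[OF svd_antidiagonal[of "{1, 2}" 1], of q] by (simp add: \<alpha>_def[abs_def])
      moreover have "svd_sum q {..2} (\<lambda>i j. antidiag_sum \<phi> \<alpha> (i + j)) (3 * \<rho> powr q)"
        using svd_sumI[OF svd_antidiagonal[of "{..2}" \<rho>], of q] \<rho> unfolding e by simp
      moreover have "min (9/8) (1 + g / V) * 2 \<le> 3 * \<rho> powr q"
      proof -
        have "min (9/8) (1 + g / V) * 2 \<le> 9/8 * 2"
          by (rule mult_right_mono[OF min.cobounded1]) simp
        also have "\<dots> \<le> 3 * \<rho> powr q" using \<rho>q by simp
        finally show ?thesis .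
      qed
      moreover have "\<forall>i j. 2 < i + j \<longrightarrow> \<alpha> i j = 0" by (auto simp: \<alpha>_def)
      ultimately show ?thesis unfolding locally_amplifies_def
        by (intro exI conjI) (assumption | simp)+
    next
      case False
      \<comment> \<open>The entries \<open>-r * \<epsilon>\<close> at \<open>(0, 2)\<close> and \<open>\<epsilon>\<close> at \<open>(1, 1)\<close> have weighted sum 0.\<close>
      define r where "r = \<phi> 1 1 / \<phi> 0 2"
      have \<phi>02: "0 < \<phi> 0 2" using False \<eta> by linarith
      have "\<phi> 1 1 \<le> 1" using \<phi>(3) nn[of 0 2] nn[of 2 0] by linarith
      then have r: "0 \<le> r" "r \<le> 1 / \<eta>"
        using nn \<phi>02 \<eta> False by (auto simp: r_def intro!: frac_le)
      define \<alpha> where "\<alpha> i j = (if i = 0 \<and> j = 0 then 1 else if i + j = 1 then sqrt 2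
         else if i = 0 \<and> j = 2 then - r * \<epsilon> else if i = 1 \<and> j = 1 then \<epsilon> else (0::real))" for i j :: nat
      define \<beta> where "\<beta> i j = antidiag_sum \<phi> \<alpha> (i + j)" for i j
      have \<beta>: "\<beta> i j = (if i + j = 0 then 1 else if i + j = 1 then sqrt 2 else 0)" for i j
      proof -
        consider "i + j = 0" | "i + j = 1" | "i + j = 2" | "2 < i + j" by linarith
        then show ?thesis
        proof cases
          case 2
          have "\<beta> i j = (\<phi> 0 1 + \<phi> 1 0) * sqrt 2"
            unfolding \<beta>_def 2 antidiag by (simp add: \<alpha>_def algebra_simps)
          then show ?thesis using 2 \<phi> by simp
        next
          case 3
          have "\<beta> i j = \<phi> 0 2 * (- r * \<epsilon>) + \<phi> 1 1 * \<epsilon>"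
            unfolding \<beta>_def 3 antidiag by (simp add: \<alpha>_def)
          also have "\<dots> = 0" using \<phi>02 by (simp add: r_def)
          finally show ?thesis using 3 by simp
        next
          case 4
          moreover have "\<beta> i j = 0"
            unfolding \<beta>_def by (rule antidiag_big[OF _ 4]) (auto simp: \<alpha>_def)
          ultimately show ?thesis using 4 by auto
        qed (simp add: \<beta>_def antidiag \<alpha>_def \<phi>)
      qed
      have s3: "(\<Sum>n\<in>{..2::nat}. f n) = f 0 + f 1 + f 2" for f :: "nat \<Rightarrow> real"
        by (simp add: numeral_2_eq_2)
      have sq2: "sqrt 2 * sqrt 2 = (2::real)" by simp
      have R1: "(\<Sum>n\<le>2. \<alpha> 0 n * \<alpha> 0 n) = 3 + r\<^sup>2 * \<epsilon>\<^sup>2"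
        and R2: "(\<Sum>n\<le>2. \<alpha> 1 n * \<alpha> 1 n) = 2 + \<epsilon>\<^sup>2"
        and G: "(\<Sum>n\<le>2. \<alpha> 0 n * \<alpha> 1 n) = sqrt 2 * (1 + \<epsilon>)"
        unfolding s3 by (simp_all add: \<alpha>_def power2_eq_square algebra_simps)
      have det: "(3 + r\<^sup>2 * \<epsilon>\<^sup>2) * (2 + \<epsilon>\<^sup>2) - (sqrt 2 * (1 + \<epsilon>))\<^sup>2 = (\<epsilon> - 2)\<^sup>2 + 2 * r\<^sup>2 * \<epsilon>\<^sup>2 + r\<^sup>2 * \<epsilon> ^ 4"
        by (simp add: power_mult_distrib power2_eq_square power4_eq_xxxx algebra_simps)
      have "0 < (\<epsilon> - 2)\<^sup>2" using \<epsilon> by auto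
      then have "0 < (\<epsilon> - 2)\<^sup>2 + 2 * r\<^sup>2 * \<epsilon>\<^sup>2 + r\<^sup>2 * \<epsilon> ^ 4" by (simp add: add_pos_nonneg)
      then obtain x y where xy: "0 < x" "0 < y" "x + y = 3 + r\<^sup>2 * \<epsilon>\<^sup>2 + (2 + \<epsilon>\<^sup>2)"
        "x * y = (\<epsilon> - 2)\<^sup>2 + 2 * r\<^sup>2 * \<epsilon>\<^sup>2 + r\<^sup>2 * \<epsilon> ^ 4"
        "svd_sum q {..2} \<alpha> (x powr (q / 2) + y powr (q / 2))"
        using svd_sum_two_rows[of \<alpha> "\<alpha> 0" "\<alpha> 1" q] unfolding R1 R2 G det by (auto simp: \<alpha>_def)
      have T: "x powr (q / 2) + y powr (q / 2) \<le> V - g"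
        by (rule gain[of "r\<^sup>2"]) (use xy r in \<open>auto simp: algebra_simps intro!: power_mono simp del: power_one_over power_divide\<close>)
      have "(\<Sum>n\<le>2. \<beta> 0 n * \<beta> 0 n) = 3" "(\<Sum>n\<le>2. \<beta> 1 n * \<beta> 1 n) = 2" "(\<Sum>n\<le>2. \<beta> 0 n * \<beta> 1 n) = sqrt 2"
        unfolding s3 \<beta> by simp_all
      then obtain x' y' where xy': "0 < x'" "0 < y'" "x' + y' = 5" "x' * y' = (4::real)"
        "svd_sum q {..2} \<beta> (x' powr (q / 2) + y' powr (q / 2))"
        using svd_sum_two_rows[of \<beta> "\<beta> 0" "\<beta> 1" q] by (auto simp: \<beta>)
      have x'eq: "x' = 5 - y'" using xy' by simp
      \<comment> \<open>The projected matrix has the squared singular values 4 and 1.\<close>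
      have "(y' - 4) * (y' - 1) = 0" using xy'(4) unfolding x'eq by (simp add: algebra_simps)
      then have "x' powr (q / 2) + y' powr (q / 2) = V" unfolding x'eq by (auto simp: V_def)
      then have T': "svd_sum q {..2} \<beta> V" using xy' by simp
      have T0: "0 < x powr (q / 2) + y powr (q / 2)" using xy by (simp add: add_pos_pos)
      have "min (9/8) (1 + g / V) * (x powr (q / 2) + y powr (q / 2)) \<le> (1 + g / V) * (V - g)"
        using T T0 g V by (intro mult_mono) auto
      also have "\<dots> \<le> V" using V g by (simp add: field_simps)
      finally have "min (9/8) (1 + g / V) * (x powr (q / 2) + y powr (q / 2)) \<le> V" .
      moreover have "\<forall>i j. 2 < i + j \<longrightarrow> \<alpha> i j = 0" by (auto simp: \<alpha>_def)
      ultimately show ?thesis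
        using xy(5) T' T0 unfolding \<beta>_def[abs_def] locally_amplifies_def
        by (intro exI conjI) (assumption | simp)+
    qed
  qed
qed

section \<open>Combining the primes\<close>

lemma bij_betw_divisors_times_prime_square:
  fixes K p :: nat
  assumes p: "prime p" "coprime p K" and K: "0 < K"
  shows "bij_betw (\<lambda>(n, i). n * p ^ i) ({n. n dvd K} \<times> {..2}) {n. n dvd K * p\<^sup>2}"
  unfolding bij_betw_def
proof
  have npd: "\<not> p dvd n" if "n dvd K" for n
    using p that by (meson coprime_common_divisor dvd_refl dvd_trans not_prime_unit)
  have mult: "multiplicity p (n * p ^ i) = i" if "n dvd K" for n i
  proof -
    have "0 < n" using that K by (rule dvd_pos_nat[rotated])
    then show ?thesis
      using npd[OF that] p(1) by (simp add: prime_elem_multiplicity_mult_distrib not_dvd_imp_multiplicity_0)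
  qed
  have key: "n = n' \<and> i = i'" if n: "n dvd K" "n' dvd K" and eq: "n * p ^ i = n' * p ^ i'" for n n' i i'
  proof -
    have "i = i'" using mult[OF n(1), of i] mult[OF n(2), of i'] unfolding eq by simp
    with eq p(1) show ?thesis by auto
  qed
  show "inj_on (\<lambda>(n, i). n * p ^ i) ({n. n dvd K} \<times> {..2})"
  proof (rule inj_onI)
    fix x y assume "x \<in> {n. n dvd K} \<times> {..2::nat}" "y \<in> {n. n dvd K} \<times> {..2::nat}"
      "(case x of (n, i) \<Rightarrow> n * p ^ i) = (case y of (n, i) \<Rightarrow> n * p ^ i)"
    then show "x = y"
      using key[of "fst x" "fst y" "snd x" "snd y"] by (auto simp: case_prod_unfold prod_eq_iff)
  qed
  show "(\<lambda>(n, i). n * p ^ i) ` ({n. n dvd K} \<times> {..2}) = {n. n dvd K * p\<^sup>2}"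
  proof (intro equalityI subsetI)
    fix m assume "m \<in> {n. n dvd K * p\<^sup>2}"
    then obtain b c where bc: "m = b * c" "b dvd K" "c dvd p\<^sup>2"
      using division_decomp by blast
    then obtain i where "i \<le> 2" "c = p ^ i" using divides_primepow_nat p(1) by blast
    with bc show "m \<in> (\<lambda>(n, i). n * p ^ i) ` ({n. n dvd K} \<times> {..2})" by force
  qed (auto intro!: mult_dvd_mono le_imp_power_dvd)
qed

text \<open>A factorisation of \<open>k p\<^sup>e\<close> is a factorisation of \<open>k\<close> together with a splitting of the exponent \<open>e\<close>.\<close>

lemma bij_betw_factor_pairs_times_prime_power:
  fixes p k :: nat
  assumes p: "prime p" "\<not> p dvd k" and k: "1 \<le> k"
  shows "bij_betw (\<lambda>((m, n), i). (m * p ^ i, n * p ^ (e - i)))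
    (factor_pairs k \<times> {..e}) (factor_pairs (k * p ^ e))"
  unfolding bij_betw_def
proof
  have npd: "\<not> p dvd m" "\<not> p dvd n" "0 < m" "0 < n" if "(m, n) \<in> factor_pairs k" for m n
    using that p by (auto simp: factor_pairs_def)
  have mult: "multiplicity p (m * p ^ i) = i" if "\<not> p dvd m" "0 < m" for m i
    using that p by (simp add: prime_elem_multiplicity_mult_distrib not_dvd_imp_multiplicity_0)
  show "inj_on (\<lambda>((m, n), i). (m * p ^ i, n * p ^ (e - i))) (factor_pairs k \<times> {..e})"
  proof (rule inj_onI)
    fix x y assume xy: "x \<in> factor_pairs k \<times> {..e}" "y \<in> factor_pairs k \<times> {..e}"
      "(\<lambda>((m, n), i). (m * p ^ i, n * p ^ (e - i))) x = (\<lambda>((m, n), i). (m * p ^ i, n * p ^ (e - i))) y"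
    obtain m n i m' n' i' where x: "x = ((m, n), i)" and y: "y = ((m', n'), i')"
      by (metis surj_pair)
    have *: "(m, n) \<in> factor_pairs k" "(m', n') \<in> factor_pairs k"
      "m * p ^ i = m' * p ^ i'" "n * p ^ (e - i) = n' * p ^ (e - i')"
      using xy unfolding x y by auto
    have "i = i'" using mult[of m i] mult[of m' i'] npd[OF *(1)] npd[OF *(2)] *(3) by simp
    moreover have "0 < p" using p(1) by (rule prime_gt_0_nat)
    ultimately show "x = y" using *(3,4) by (simp add: x y)
  qed
  show "(\<lambda>((m, n), i). (m * p ^ i, n * p ^ (e - i))) ` (factor_pairs k \<times> {..e}) = factor_pairs (k * p ^ e)"
  proof (intro equalityI subsetI)
    fix z assume "z \<in> (\<lambda>((m, n), i). (m * p ^ i, n * p ^ (e - i))) ` (factor_pairs k \<times> {..e})"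
    then obtain m n i where *: "z = (m * p ^ i, n * p ^ (e - i))" "(m, n) \<in> factor_pairs k" "i \<le> e" by auto
    have "m * p ^ i * (n * p ^ (e - i)) = m * n * p ^ (i + (e - i))" by (simp add: power_add mult_ac)
    with * p(1) show "z \<in> factor_pairs (k * p ^ e)"
      by (auto simp: factor_pairs_def Suc_le_eq prime_gt_0_nat)
  next
    fix z assume "z \<in> factor_pairs (k * p ^ e)"
    then obtain M N where z: "z = (M, N)" "0 < M" "0 < N" "M * N = k * p ^ e"
      by (auto simp: factor_pairs_def)
    obtain m where m: "M = p ^ multiplicity p M * m" "\<not> p dvd m"
      using multiplicity_decompose'[of M p] z p by (metis not_prime_unit not_less0)
    obtain n where n: "N = p ^ multiplicity p N * n" "\<not> p dvd n"
      using multiplicity_decompose'[of N p] z p by (metis not_prime_unit not_less0)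
    have "multiplicity p (M * N) = multiplicity p (k * p ^ e)" using z by simp
    moreover have "multiplicity p (k * p ^ e) = e" using mult p k by simp
    moreover have "multiplicity p (M * N) = multiplicity p M + multiplicity p N"
      using z p by (intro prime_elem_multiplicity_mult_distrib) auto
    ultimately have e: "multiplicity p M + multiplicity p N = e" by simp
    have "M * N = m * n * p ^ e" unfolding e[symmetric] power_add
      by (metis m(1) n(1) mult.assoc mult.commute mult.left_commute)
    then have "m * n = k" using z p(1) prime_gt_0_nat[of p] by simp
    then have "(m, n) \<in> factor_pairs k" using k by (auto simp: factor_pairs_def Suc_le_eq)
    moreover have "z = (m * p ^ multiplicity p M, n * p ^ (e - multiplicity p M))"
      using z(1) m(1) n(1) e by (metis add_diff_cancel_left' mult.commute)
    ultimately show "z \<in> (\<lambda>((m, n), i). (m * p ^ i, n * p ^ (e - i))) ` (factor_pairs k \<times> {..e})"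
      using e by force
  qed
qed

text \<open>The common value of the entries \<open>(m, n)\<close> with \<open>m * n = k\<close> of the projected matrix; all test
  matrices are real.\<close>

definition weighted_mean :: "(nat \<Rightarrow> nat \<Rightarrow> real) \<Rightarrow> (nat \<Rightarrow> nat \<Rightarrow> real) \<Rightarrow> nat \<Rightarrow> real" where
  "weighted_mean \<Phi> a k = (\<Sum>(i, j)\<in>factor_pairs k. \<Phi> i j * a i j)"

lemma weighted_projection_of_real:
  "weighted_projection \<Phi> (\<lambda>m n. complex_of_real (a m n)) = (\<lambda>m n. complex_of_real (weighted_mean \<Phi> a (m * n)))"
  by (simp add: weighted_projection_def weighted_mean_def fun_eq_iff case_prod_unfold)

text \<open>The tensor product of \<open>a\<close> and \<open>\<alpha>\<close>, where an index is split into its part prime to \<open>p\<close> and its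
  exponent of \<open>p\<close>.\<close>

definition prime_tensor :: "nat \<Rightarrow> (nat \<Rightarrow> nat \<Rightarrow> real) \<Rightarrow> (nat \<Rightarrow> nat \<Rightarrow> real) \<Rightarrow> nat \<Rightarrow> nat \<Rightarrow> real" where
  "prime_tensor p a \<alpha> m n =
     a (m div p ^ multiplicity p m) (n div p ^ multiplicity p n) * \<alpha> (multiplicity p m) (multiplicity p n)"

lemma prime_tensor_times_powers:
  assumes "prime p" "\<not> p dvd m" "\<not> p dvd n"
  shows "prime_tensor p a \<alpha> (m * p ^ i) (n * p ^ j) = a m n * \<alpha> i j"
proof -
  have "multiplicity p (x * p ^ l) = l" if "\<not> p dvd x" for x l
    using that assms(1) by (cases "x = 0")
      (simp_all add: prime_elem_multiplicity_mult_distrib not_dvd_imp_multiplicity_0)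
  then show ?thesis using assms by (simp add: prime_tensor_def prime_gt_0_nat)
qed

text \<open>Both the weights and the factorisations split into a part prime to \<open>p\<close> and a power of \<open>p\<close>.\<close>

lemma weighted_mean_prime_tensor:
  assumes mult: "multiplicative2 \<Phi>" and p: "prime p" "\<not> p dvd k" and k: "1 \<le> k"
  shows "weighted_mean \<Phi> (prime_tensor p a \<alpha>) (k * p ^ e) =
    weighted_mean \<Phi> a k * antidiag_sum (\<lambda>i j. \<Phi> (p ^ i) (p ^ j)) \<alpha> e"
proof -
  let ?h = "\<lambda>((m, n), i). (m * p ^ i, n * p ^ (e - i))"
  let ?f = "\<lambda>(i, j). \<Phi> i j * prime_tensor p a \<alpha> i j"
  have "weighted_mean \<Phi> (prime_tensor p a \<alpha>) (k * p ^ e) = (\<Sum>z\<in>factor_pairs k \<times> {..e}. ?f (?h z))"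
    unfolding weighted_mean_def
    by (rule sum.reindex_bij_betw[OF bij_betw_factor_pairs_times_prime_power[OF p k], symmetric])
  also have "\<dots> = (\<Sum>(x, i)\<in>factor_pairs k \<times> {..e}.
      (case x of (m, n) \<Rightarrow> \<Phi> m n * a m n) * (\<Phi> (p ^ i) (p ^ (e - i)) * \<alpha> i (e - i)))"
  proof (rule sum.cong[OF refl], clarify)
    fix m n i assume mn: "(m, n) \<in> factor_pairs k"
    then have *: "1 \<le> m" "1 \<le> n" "m * n = k" by (auto simp: factor_pairs_def)
    have npd: "\<not> p dvd m" "\<not> p dvd n" using p(2) *(3) by auto
    have cop: "coprime (m * n) (p ^ i * p ^ (e - i))"
      using p *(3) by (metis coprime_commute coprime_mult_right_iff coprime_power_right_iff prime_imp_coprime)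
    have pos: "1 \<le> p ^ i" "1 \<le> p ^ (e - i)" using p(1) by (auto simp: Suc_le_eq prime_gt_0_nat)
    have "\<Phi> (m * p ^ i) (n * p ^ (e - i)) = \<Phi> m n * \<Phi> (p ^ i) (p ^ (e - i))"
      using mult *(1,2) pos cop unfolding multiplicative2_def by blast
    then show "\<Phi> (m * p ^ i) (n * p ^ (e - i)) * prime_tensor p a \<alpha> (m * p ^ i) (n * p ^ (e - i)) =
      \<Phi> m n * a m n * (\<Phi> (p ^ i) (p ^ (e - i)) * \<alpha> i (e - i))"
      using npd p(1) by (simp add: prime_tensor_times_powers)
  qed
  also have "\<dots> = weighted_mean \<Phi> a k * antidiag_sum (\<lambda>i j. \<Phi> (p ^ i) (p ^ j)) \<alpha> e"
    by (simp add: weighted_mean_def antidiag_sum_def sum_product sum.cartesian_product case_prod_unfold)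
  finally show ?thesis .
qed

lemma sum_factor_pairs_prime_power:
  assumes "prime p"
  shows "(\<Sum>(m, n)\<in>factor_pairs (p ^ e). \<Phi> m n) = (\<Sum>i\<le>e. \<Phi> (p ^ i) (p ^ (e - i)) :: real)"
proof -
  have p: "\<not> p dvd 1" using assms by auto
  have one: "factor_pairs 1 = {(1, 1)}" by (auto simp: factor_pairs_def)
  have "(\<Sum>z\<in>factor_pairs 1 \<times> {..e}. (\<lambda>(m, n). \<Phi> m n) ((\<lambda>((m, n), i). (m * p ^ i, n * p ^ (e - i))) z))
      = (\<Sum>z\<in>factor_pairs (1 * p ^ e). (\<lambda>(m, n). \<Phi> m n) z)"
    by (rule sum.reindex_bij_betw[OF bij_betw_factor_pairs_times_prime_power[OF assms p]]) simp
  moreover have "(\<Sum>z\<in>factor_pairs 1 \<times> {..e}. (\<lambda>(m, n). \<Phi> m n) ((\<lambda>((m, n), i). (m * p ^ i, n * p ^ (e - i))) z))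
      = (\<Sum>i\<le>e. \<Phi> (p ^ i) (p ^ (e - i)))"
    unfolding one sum.cartesian_product' by simp
  ultimately show ?thesis by simp
qed

text \<open>Requiring \<open>a m n = 0\<close> unless \<open>m * n\<close>, and not only \<open>m\<close> and \<open>n\<close>, divides \<open>K\<close> makes the projected
  matrix live on the divisors of \<open>K\<close> as well.\<close>

definition amplifies :: "real \<Rightarrow> (nat \<Rightarrow> nat \<Rightarrow> real) \<Rightarrow> real \<Rightarrow> bool" where
  "amplifies q \<Phi> r \<longleftrightarrow> (\<exists>K a S S'. 0 < K \<and> (\<forall>m n. \<not> m * n dvd K \<longrightarrow> a m n = 0) \<and>
     svd_sum q {n. n dvd K} a S \<and> svd_sum q {n. n dvd K} (\<lambda>m n. weighted_mean \<Phi> a (m * n)) S' \<and>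
     0 < S \<and> r * S \<le> S')"

lemma amplifies_1:
  assumes "\<Phi> 1 1 = 1"
  shows "amplifies q \<Phi> 1"
proof -
  define a :: "nat \<Rightarrow> nat \<Rightarrow> real" where "a m n = (if m * n dvd 1 then 1 else 0)" for m n
  have svd1: "svd_sum q {n. n dvd 1} b 1" if "b 1 1 = 1" for b
  proof -
    have "svd {n. n dvd 1} b {0::nat} (\<lambda>_. 1) (\<lambda>_ _. 1) (\<lambda>_ _. 1)"
      using that by (simp add: svd_def orthonormal_on_def)
    from svd_sumI[OF this, of q] show ?thesis by simp
  qed
  have "factor_pairs 1 = {(1, 1)}" by (auto simp: factor_pairs_def)
  then have "weighted_mean \<Phi> a (1 * 1) = 1" using assms by (simp add: weighted_mean_def a_def)
  then have "svd_sum q {n. n dvd 1} (\<lambda>m n. weighted_mean \<Phi> a (m * n)) 1" by (rule svd1)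
  moreover have "svd_sum q {n. n dvd 1} a 1" by (rule svd1) (simp add: a_def)
  moreover have "\<forall>m n. \<not> m * n dvd 1 \<longrightarrow> a m n = 0" by (simp add: a_def)
  ultimately show ?thesis unfolding amplifies_def
    by (intro exI[of _ "1::nat"] exI[of _ a] exI[of _ "1::real"] conjI) simp_all
qed

text \<open>A prime larger than \<open>K\<close> has not been used yet, so its local matrix can be tensored on.\<close>

lemma amplifies_mult:
  assumes mult: "multiplicative2 \<Phi>"
    and r: "amplifies q \<Phi> r" "0 \<le> r" and R: "0 \<le> R"
    and local: "\<And>p. prime p \<Longrightarrow> locally_amplifies q (\<lambda>i j. \<Phi> (p ^ i) (p ^ j)) R"
  shows "amplifies q \<Phi> (r * R)"
proof -
  from r(1)[unfolded amplifies_def] obtain K a S S' where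
    K: "0 < K" and supp: "\<And>m n. \<not> m * n dvd K \<Longrightarrow> a m n = 0"
    and S: "svd_sum q {n. n dvd K} a S" "svd_sum q {n. n dvd K} (\<lambda>m n. weighted_mean \<Phi> a (m * n)) S'"
    "0 < S" "r * S \<le> S'"
    by blast
  obtain p where p: "prime p" "K < p" using bigger_prime by blast
  have npK: "\<not> p dvd K" using p K by (auto dest: dvd_imp_le)
  have cop: "coprime p K" using p(1) npK by (rule prime_imp_coprime)
  define \<phi> where "\<phi> = (\<lambda>i j. \<Phi> (p ^ i) (p ^ j))"
  from local[OF p(1), folded \<phi>_def, unfolded locally_amplifies_def]
  obtain \<alpha> T T' where \<alpha>: "\<And>i j. 2 < i + j \<Longrightarrow> \<alpha> i j = 0" and T: "svd_sum q {..2} \<alpha> T"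
     "svd_sum q {..2} (\<lambda>i j. antidiag_sum \<phi> \<alpha> (i + j)) T'" "0 < T" "R * T \<le> T'"
    by blast
  let ?a = "prime_tensor p a \<alpha>"
  note bij = bij_betw_divisors_times_prime_square[OF p(1) cop K]
  have npd: "\<not> p dvd n" if "n \<in> {n. n dvd K}" for n using npK that dvd_trans by blast
  have 1: "svd_sum q {n. n dvd K * p\<^sup>2} ?a (S * T)"
    by (rule svd_sum_tensor[OF S(1) T(1) bij]) (simp add: prime_tensor_times_powers p(1) npd)
  have 2: "svd_sum q {n. n dvd K * p\<^sup>2} (\<lambda>m n. weighted_mean \<Phi> ?a (m * n)) (S' * T')"
  proof (rule svd_sum_tensor[OF S(2) T(2) bij])
    fix m n i j :: nat assume mn: "m \<in> {n. n dvd K}" "n \<in> {n. n dvd K}"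
    have "\<not> p dvd m * n" using npd[OF mn(1)] npd[OF mn(2)] p(1) by (simp add: prime_dvd_mult_iff)
    moreover have "0 < m" "0 < n" using mn K by (auto intro: Nat.gr0I)
    then have "1 \<le> m * n" by simp
    ultimately have "weighted_mean \<Phi> ?a (m * n * p ^ (i + j)) = weighted_mean \<Phi> a (m * n) * antidiag_sum \<phi> \<alpha> (i + j)"
      unfolding \<phi>_def by (rule weighted_mean_prime_tensor[OF mult p(1)])
    moreover have eq: "m * p ^ i * (n * p ^ j) = m * n * p ^ (i + j)" by (simp add: power_add mult_ac)
    ultimately show "weighted_mean \<Phi> ?a ((case (m, i) of (n, i) \<Rightarrow> n * p ^ i) * (case (n, j) of (n, i) \<Rightarrow> n * p ^ i)) =
      weighted_mean \<Phi> a (m * n) * antidiag_sum \<phi> \<alpha> (i + j)"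
      by (simp only: prod.case eq)
  qed
  have 3: "?a m n = 0" if "\<not> m * n dvd K * p\<^sup>2" for m n
  proof (rule ccontr)
    assume ne: "?a m n \<noteq> 0"
    define i j m' n' where "i = multiplicity p m" and "j = multiplicity p n"
      and "m' = m div p ^ i" and "n' = n div p ^ j"
    have mn: "m = m' * p ^ i" "n = n' * p ^ j"
      by (simp_all add: i_def j_def m'_def n'_def multiplicity_dvd)
    have "a m' n' \<noteq> 0" "\<alpha> i j \<noteq> 0"
      using ne by (simp_all add: prime_tensor_def i_def j_def m'_def n'_def)
    then have "m' * n' dvd K" "i + j \<le> 2" using supp \<alpha> by (auto simp: not_less[symmetric])
    then have "m' * n' * p ^ (i + j) dvd K * p\<^sup>2" by (intro mult_dvd_mono le_imp_power_dvd)
    moreover have "m' * n' * p ^ (i + j) = m * n" unfolding mn by (simp add: power_add mult_ac)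
    ultimately show False using that by simp
  qed
  have "r * R * (S * T) = (r * S) * (R * T)" by simp
  also have "\<dots> \<le> S' * T'"
  proof (rule mult_mono)
    have "0 \<le> r * S" using r(2) S(3) by simp
    then show "0 \<le> S'" using S(4) by linarith
  qed (use S T R in auto)
  finally have 4: "r * R * (S * T) \<le> S' * T'" .
  have 5: "0 < K * p\<^sup>2" "0 < S * T" using K S(3) T(3) prime_gt_0_nat[OF p(1)] by auto
  show ?thesis unfolding amplifies_def
    by (intro exI[of _ "K * p\<^sup>2"] exI[of _ ?a] exI[of _ "S * T"] exI[of _ "S' * T'"] conjI allI impI)
       (fact 1 2 3 4 5)+
qed

text \<open>The test matrices define finite rank operators, and any operator with the projected matrix is the
  finite rank operator of that matrix. So the bound on the projection becomes a bound between the two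
  power sums.\<close>

lemma bounded_imp_amplification_bounded:
  assumes q: "0 < q" and bdd: "bounded_on_schatten q (weighted_projection \<Phi>)"
  shows "\<exists>C. \<forall>r\<ge>0. amplifies q \<Phi> r \<longrightarrow> r powr (1 / q) \<le> C"
proof -
  obtain C where C: "\<And>A a. \<lbrakk>A \<in> schatten_class q; has_matrix A a\<rbrakk> \<Longrightarrow>
    \<exists>B \<in> schatten_class q. has_matrix B (weighted_projection \<Phi> a) \<and> schatten_norm q B \<le> C * schatten_norm q A"
    using bdd unfolding bounded_on_schatten_def by blast
  have "r powr (1 / q) \<le> C" if r: "0 \<le> r" "amplifies q \<Phi> r" for r
  proof -
    from r(2)[unfolded amplifies_def] obtain K a S S' where
      K: "0 < K" and supp: "\<And>m n. \<not> m * n dvd K \<Longrightarrow> a m n = 0"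
      and S: "svd_sum q {n. n dvd K} a S" "svd_sum q {n. n dvd K} (\<lambda>m n. weighted_mean \<Phi> a (m * n)) S'"
      "0 < S" "r * S \<le> S'"
      by blast
    define F where "F = {n. n dvd K}"
    have F: "finite F" "0 \<notin> F" using K by (auto simp: F_def)
    let ?b = "\<lambda>m n. weighted_mean \<Phi> a (m * n)"
    have out: "\<not> m * n dvd K" if "\<not> (m \<in> F \<and> n \<in> F)" for m n
      using that dvd_mult_left[of m n K] dvd_mult_right[of m n K] by (simp add: F_def) blast
    have mean0: "weighted_mean \<Phi> a k = 0" if "\<not> k dvd K" for k
      unfolding weighted_mean_def
    proof (rule sum.neutral, clarify)
      fix i j assume "(i, j) \<in> factor_pairs k"
      then have "i * j = k" by (simp add: factor_pairs_def)
      with that supp[of i j] show "\<Phi> i j * a i j = 0" by simp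
    qed
    have matA: "has_matrix (fin_op F a) (\<lambda>m n. of_real (a m n))"
      using F by (rule has_matrix_fin_op) (rule supp[OF out])
    have matB: "has_matrix (fin_op F ?b) (weighted_projection \<Phi> (\<lambda>m n. of_real (a m n)))"
      unfolding weighted_projection_of_real
      using F by (rule has_matrix_fin_op) (rule mean0[OF out])
    have A: "fin_op F a \<in> schatten_class q" "schatten_norm q (fin_op F a) = S powr (1 / q)"
      using S(1) schatten_fin_op[OF _ F(2)] unfolding svd_sum_def F_def by blast+
    have normB: "schatten_norm q (fin_op F ?b) = S' powr (1 / q)"
      using S(2) schatten_fin_op[OF _ F(2)] unfolding svd_sum_def F_def by blast
    obtain B where B: "B \<in> schatten_class q" "has_matrix B (weighted_projection \<Phi> (\<lambda>m n. of_real (a m n)))"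
      "schatten_norm q B \<le> C * schatten_norm q (fin_op F a)"
      using C[OF A(1) matA] by blast
    have "bounded_op B" using B(1) by (simp add: schatten_class_def compact_op_def)
    then have "B = fin_op F ?b"
      by (rule has_matrix_unique[OF _ B(2) bounded_op_fin_op[OF F] matB])
    then have "S' powr (1 / q) \<le> C * S powr (1 / q)" using B(3) A(2) normB by simp
    moreover have "(r * S) powr (1 / q) \<le> S' powr (1 / q)"
      using q r(1) S(3,4) by (intro powr_mono2) auto
    moreover have "(r * S) powr (1 / q) = r powr (1 / q) * S powr (1 / q)"
      using r(1) S(3) by (simp add: powr_mult)
    ultimately have "r powr (1 / q) * S powr (1 / q) \<le> C * S powr (1 / q)" by linarith
    then show ?thesis by (rule mult_right_le_imp_le) (use S(3) in simp)
  qed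
  then show ?thesis by blast
qed

theorem theorem2:
  fixes \<Phi> :: "nat \<Rightarrow> nat \<Rightarrow> real" and q :: real
  assumes nonneg: "\<And>m n. m \<ge> 1 \<Longrightarrow> n \<ge> 1 \<Longrightarrow> \<Phi> m n \<ge> 0"
    and mult: "multiplicative2 \<Phi>"
    and sum_one: "\<And>k. k \<ge> 1 \<Longrightarrow> (\<Sum>(m, n)\<in>factor_pairs k. \<Phi> m n) = 1"
    and q: "1 \<le> q" "q \<noteq> 2"
  shows "\<not> bounded_on_schatten q (weighted_projection \<Phi>)"
proof
  assume bdd: "bounded_on_schatten q (weighted_projection \<Phi>)"
  obtain R where R: "1 < R" and gain: "\<And>\<phi>. \<lbrakk>\<And>i j. 0 \<le> \<phi> i j; \<phi> 0 0 = 1; \<phi> 0 1 + \<phi> 1 0 = 1;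
      \<phi> 0 2 + \<phi> 1 1 + \<phi> 2 0 = 1\<rbrakk> \<Longrightarrow> locally_amplifies q \<phi> R"
    using uniform_local_amplification[OF q] by blast
  have local: "locally_amplifies q (\<lambda>i j. \<Phi> (p ^ i) (p ^ j)) R" if p: "prime p" for p
  proof (rule gain)
    have p1: "1 \<le> p ^ i" for i using p by (simp add: Suc_le_eq prime_gt_0_nat)
    have row: "(\<Sum>i\<le>e. \<Phi> (p ^ i) (p ^ (e - i))) = 1" for e
      unfolding sum_factor_pairs_prime_power[OF p, symmetric] using p1 by (rule sum_one)
    show "0 \<le> \<Phi> (p ^ i) (p ^ j)" for i j using p1 p1 by (rule nonneg)
    show "\<Phi> (p ^ 0) (p ^ 0) = 1" using row[of 0] by simp
    show "\<Phi> (p ^ 0) (p ^ 1) + \<Phi> (p ^ 1) (p ^ 0) = 1" using row[of 1] by simp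
    show "\<Phi> (p ^ 0) (p ^ 2) + \<Phi> (p ^ 1) (p ^ 1) + \<Phi> (p ^ 2) (p ^ 0) = 1"
      using row[of 2] by (simp add: numeral_2_eq_2)
  qed
  have amp: "amplifies q \<Phi> (R ^ d)" for d
  proof (induction d)
    case 0
    show ?case using amplifies_1 mult by (simp add: multiplicative2_def)
  next
    case (Suc d)
    have "amplifies q \<Phi> (R ^ d * R)"
      by (rule amplifies_mult[OF mult Suc _ _ local]) (use R in auto)
    then show ?case by (simp add: mult.commute)
  qed
  obtain C where C: "\<And>r. 0 \<le> r \<Longrightarrow> amplifies q \<Phi> r \<Longrightarrow> r powr (1 / q) \<le> C"
    using bounded_imp_amplification_bounded[OF _ bdd] q by auto
  have "1 < R powr (1 / q)" using powr_less_mono2[of "1 / q" 1 R] R q by simp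
  then obtain d where "C < (R powr (1 / q)) ^ d" using real_arch_pow by blast
  also have "(R powr (1 / q)) ^ d = (R ^ d) powr (1 / q)"
    using R by (simp add: powr_powr mult.commute flip: powr_realpow)
  also have "\<dots> \<le> C" using C[OF _ amp[of d]] R by simp
  finally show False by simp
qed

end
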